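(* Let $N\geq 3$ be an integer and let $A$ be an $N$-Koszul Artin-Schelter regular algebra over a field $\mathbb{K}$ of finite global dimension $d$. If the Hilbert series of $A$ is that of a weighted polynomial ring and $A$ has GK dimension $d$, then $A$ is a $3$-Koszul Artin-Schelter regular algebra of global dimension $3$.
   Context: Fix a field $\mathbb{K}$. Graded algebra means an $\mathbb{N}$-graded $\mathbb{K}$-algebra $A=A_0\oplus A_1\oplus A_2\oplus\cdots$ with $A_iA_j\subset A_{i+j}$; all graded algebras are assumed locally finite ($\dim_{\mathbb{K}}A_n<\infty$ for all $n$), connected ($A_0=\mathbb{K}$), and generated in degree one (generated by $A_1$ as a $\mathbb{K}$-algebra). Modules are $\mathbb{Z}$-graded left modules. The trivial module is $\mathbb{K}=A/A_+$ with $A_+=A_1\oplus A_2\oplus\cdots$. Hilbert series: $h_A(t)=\sum_{i\geq 0}(\dim_{\mathbb{K}}A_i)t^i$. $A$ has the Hilbert series of a weighted polynomial ring if there are a positive integer $m$ and nonnegative integers $n_1,\dots,n_m$ with $h_A(t)=\prod_{i=1}^m\frac{1}{(1-t^i)^{n_i}}$. Global dimension: the (left, right, graded or ungraded) global dimensions of such an $A$ all coincide, and equal the projective dimension of $\mathbb{K}$; the common value is called the global dimension. GK dimension: $\operatorname{GKdim}(A)=\limsup_{n\to\infty}\log_n d(n)$, where $d(n)=\dim_{\mathbb{K}}(\mathbb{K}\oplus A_1\oplus\cdots\oplus A_n)$. $N$-Koszul ($N\geq 2$): $A$ is $N$-Koszul if the trivial left module $\mathbb{K}$ has a minimal projective resolution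 $\cdots\to P^i\to\cdots\to P^1\to P^0\to\mathbb{K}\to 0$ in which each $P^i$ is generated in degree $\nu_i$, where $\nu_i=\frac{i}{2}N$ if $i$ is even and $\nu_i=\frac{i-1}{2}N+1$ if $i$ is odd. Artin-Schelter (AS) regular: a finitely generated graded algebra $A$ over $\mathbb{K}$ is AS regular if it (1) has finite global dimension $d$; (2) has finite GK dimension, i.e. there exist $c,e>0$ with $\dim_{\mathbb{K}}A_n\leq cn^e$ for all $n\geq 1$; (3) is Gorenstein, i.e. $\operatorname{Ext}^q_A(\mathbb{K},A)=0$ for $q\neq d$ and $\operatorname{Ext}^d_A(\mathbb{K},A)\simeq\mathbb{K}$.
   Formalization: The formal theorem adds the hypothesis d ≥ 2: for d = 1 the polynomial ring K[x] (and for d = 0 the field K) is N-Koszul for every N and meets all the hypotheses, but its global dimension is not 3, so the statement fails there. *)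

theory Defs
  imports
    "HOL-Library.Function_Algebras"
    "HOL-Library.Extended_Nat"
    "HOL-Library.Extended_Real"
    "HOL-Library.Liminf_Limsup"
    "HOL-Computational_Algebra.Formal_Power_Series"
    Complex_Main
begin

definition add_subgroup :: "'m::ab_group_add set \<Rightarrow> bool" where
  "add_subgroup S \<longleftrightarrow> 0 \<in> S \<and> (\<forall>x\<in>S. \<forall>y\<in>S. x - y \<in> S)"

definition direct_sum_of :: "'m::ab_group_add set \<Rightarrow> ('i \<Rightarrow> 'm set) \<Rightarrow> bool" where
  "direct_sum_of S C \<longleftrightarrow>
     add_subgroup S \<and> (\<forall>i. add_subgroup (C i) \<and> C i \<subseteq> S) \<and>
     (\<forall>x\<in>S. \<exists>!f. (\<forall>i. f i \<in> C i) \<and> finite {i. f i \<noteq> 0} \<and> x = (\<Sum>i | f i \<noteq> 0. f i))"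

text \<open>
  The algebra is the whole type \<open>'a\<close>, and \<open>gr n\<close> is its component of degree \<open>n\<close>.
  As a standing convention a graded algebra is connected, locally finite
  and generated in degree one.
\<close>

locale graded_algebra = vector_space scale
  for scale :: "'k::field \<Rightarrow> 'a::ring_1 \<Rightarrow> 'a" +
  fixes gr :: "nat \<Rightarrow> 'a set"
  assumes scale_mult_left: "scale c x * y = scale c (x * y)"
    and scale_mult_right: "x * scale c y = scale c (x * y)"
    and gr_subspace: "subspace (gr n)"
    and gr_direct_sum: "direct_sum_of UNIV gr"
    and gr_mult: "\<lbrakk>x \<in> gr i; y \<in> gr j\<rbrakk> \<Longrightarrow> x * y \<in> gr (i + j)"
    and connected: "gr 0 = range (\<lambda>c. scale c 1)"
    and locally_finite: "\<exists>B. finite B \<and> gr n = span B"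
    and generated_in_degree_one:
      "\<lbrakk>subspace S; 1 \<in> S; \<And>x y. \<lbrakk>x \<in> S; y \<in> S\<rbrakk> \<Longrightarrow> x * y \<in> S; gr 1 \<subseteq> S\<rbrakk> \<Longrightarrow> S = UNIV"

record ('a, 'm) gmod =
  carrier :: "'m set"
  act :: "'a \<Rightarrow> 'm \<Rightarrow> 'm"
  hcomp :: "int \<Rightarrow> 'm set"

text \<open>
  A definition cannot quantify over all types, so projectivity is tested on, resolutions are built
  from, and the global dimension is taken over modules whose carrier is an additive subgroup of
  \<open>nat \<Rightarrow> 'a\<close>, with an arbitrary action and grading.  This is no restriction.  The algebra has
  countable dimension over the field \<open>K\<close>, so \<open>nat \<Rightarrow> 'a\<close> has
  dimension \<open>\<lambda> = |K|\<^sup>\<omega>\<close>, which is infinite, and every graded module of dimension at most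
  \<open>\<lambda>\<close> has an isomorphic copy there.  These modules include all countably
  generated ones, in particular all cyclic ones (which already determine the global dimension)
  and the terms of the minimal resolution of the trivial module, and they are closed under
  submodules, quotients and free covers.
\<close>

type_synonym 'a umod = "('a, nat \<Rightarrow> 'a) gmod"

context graded_algebra
begin

definition graded_module :: "('a, 'm::ab_group_add) gmod \<Rightarrow> bool" where
  "graded_module M \<longleftrightarrow>
     direct_sum_of (carrier M) (hcomp M) \<and>
     (\<forall>a. \<forall>x\<in>carrier M. act M a x \<in> carrier M) \<and>
     (\<forall>x\<in>carrier M. act M 1 x = x) \<and>
     (\<forall>a b. \<forall>x\<in>carrier M. act M (a * b) x = act M a (act M b x)) \<and>
     (\<forall>a b. \<forall>x\<in>carrier M. act M (a + b) x = act M a x + act M b x) \<and>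
     (\<forall>a. \<forall>x\<in>carrier M. \<forall>y\<in>carrier M. act M a (x + y) = act M a x + act M a y) \<and>
     (\<forall>i j. \<forall>a\<in>gr i. \<forall>x\<in>hcomp M j. act M a x \<in> hcomp M (int i + j))"

definition module_map ::
    "('a, 'm::ab_group_add) gmod \<Rightarrow> ('a, 'n::ab_group_add) gmod \<Rightarrow> ('m \<Rightarrow> 'n) \<Rightarrow> bool" where
  "module_map M N f \<longleftrightarrow>
     (\<forall>x\<in>carrier M. f x \<in> carrier N) \<and>
     (\<forall>x\<in>carrier M. \<forall>y\<in>carrier M. f (x + y) = f x + f y) \<and>
     (\<forall>a. \<forall>x\<in>carrier M. f (act M a x) = act N a (f x))"

definition graded_map ::
    "('a, 'm::ab_group_add) gmod \<Rightarrow> ('a, 'n::ab_group_add) gmod \<Rightarrow> ('m \<Rightarrow> 'n) \<Rightarrow> bool" where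
  "graded_map M N f \<longleftrightarrow> module_map M N f \<and> (\<forall>i. f ` hcomp M i \<subseteq> hcomp N i)"

definition kernel_of ::
    "('a, 'm::ab_group_add) gmod \<Rightarrow> ('m \<Rightarrow> 'n::ab_group_add) \<Rightarrow> 'm set" where
  "kernel_of M f = {x \<in> carrier M. f x = 0}"

definition projective :: "'a umod \<Rightarrow> bool" where
  "projective P \<longleftrightarrow> graded_module P \<and>
     (\<forall>(M::'a umod) (N::'a umod) f g.
        graded_module M \<and> graded_module N \<and> graded_map P N f \<and>
        graded_map M N g \<and> g ` carrier M = carrier N \<longrightarrow>
        (\<exists>h. graded_map P M h \<and> (\<forall>x\<in>carrier P. g (h x) = f x)))"

definition generated_in_degree :: "('a, 'm::ab_group_add) gmod \<Rightarrow> int \<Rightarrow> bool" where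
  "generated_in_degree M j \<longleftrightarrow>
     (\<forall>S\<subseteq>carrier M. add_subgroup S \<and> (\<forall>a. \<forall>x\<in>S. act M a x \<in> S) \<and> hcomp M j \<subseteq> S
        \<longrightarrow> S = carrier M)"

definition A_plus :: "'a set" where
  "A_plus = span (\<Union>n\<in>{1..}. gr n)"

definition A_plus_mult :: "('a, 'm::ab_group_add) gmod \<Rightarrow> 'm set" where
  "A_plus_mult M = add_subgroup hull {act M a x | a x. a \<in> A_plus \<and> x \<in> carrier M}"

text \<open>The trivial module \<open>A / A\<^sub>+\<close>, identified with the field through the augmentation.\<close>

definition augmentation :: "'a \<Rightarrow> 'k" where
  "augmentation a = (THE c. a - scale c 1 \<in> A_plus)"

definition trivial_module :: "('a, 'k) gmod" where
  "trivial_module =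
     \<lparr>carrier = UNIV, act = (\<lambda>a c. augmentation a * c), hcomp = (\<lambda>i. if i = 0 then UNIV else {0})\<rparr>"

definition regular_module :: "('a, 'a) gmod" where
  "regular_module =
     \<lparr>carrier = UNIV, act = (*), hcomp = (\<lambda>i. if i \<ge> 0 then gr (nat i) else {0})\<rparr>"

text \<open>\<open>\<delta> i : P (i + 1) \<rightarrow> P i\<close> are the differentials and \<open>e : P 0 \<rightarrow> M\<close> is the augmentation.\<close>

definition projective_resolution ::
    "('a, 'm::ab_group_add) gmod \<Rightarrow> (nat \<Rightarrow> 'a umod) \<Rightarrow>
     (nat \<Rightarrow> (nat \<Rightarrow> 'a) \<Rightarrow> (nat \<Rightarrow> 'a)) \<Rightarrow> ((nat \<Rightarrow> 'a) \<Rightarrow> 'm) \<Rightarrow> bool" where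
  "projective_resolution M P \<delta> e \<longleftrightarrow>
     (\<forall>i. projective (P i)) \<and>
     (\<forall>i. graded_map (P (Suc i)) (P i) (\<delta> i)) \<and>
     graded_map (P 0) M e \<and>
     e ` carrier (P 0) = carrier M \<and>
     kernel_of (P 0) e = \<delta> 0 ` carrier (P 1) \<and>
     (\<forall>i. kernel_of (P (Suc i)) (\<delta> i) = \<delta> (Suc i) ` carrier (P (Suc (Suc i))))"

definition minimal_projective_resolution ::
    "('a, 'm::ab_group_add) gmod \<Rightarrow> (nat \<Rightarrow> 'a umod) \<Rightarrow>
     (nat \<Rightarrow> (nat \<Rightarrow> 'a) \<Rightarrow> (nat \<Rightarrow> 'a)) \<Rightarrow> ((nat \<Rightarrow> 'a) \<Rightarrow> 'm) \<Rightarrow> bool" where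
  "minimal_projective_resolution M P \<delta> e \<longleftrightarrow>
     projective_resolution M P \<delta> e \<and> (\<forall>i. \<delta> i ` carrier (P (Suc i)) \<subseteq> A_plus_mult (P i))"

definition proj_dim :: "('a, 'm::ab_group_add) gmod \<Rightarrow> enat" where
  "proj_dim M =
     Inf {enat n | n. \<exists>P \<delta> e. projective_resolution M P \<delta> e \<and> (\<forall>i>n. carrier (P i) = {0})}"

definition gldim :: enat where
  "gldim = (SUP M \<in> {M::'a umod. graded_module M}. proj_dim M)"

definition koszul_degree :: "nat \<Rightarrow> nat \<Rightarrow> nat" where
  "koszul_degree N i = (if even i then (i div 2) * N else ((i - 1) div 2) * N + 1)"

definition N_Koszul :: "nat \<Rightarrow> bool" where
  "N_Koszul N \<longleftrightarrow> N \<ge> 2 \<and>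
     (\<exists>P \<delta> e. minimal_projective_resolution trivial_module P \<delta> e \<and>
        (\<forall>i. generated_in_degree (P i) (int (koszul_degree N i))))"

definition hilbert_series :: "real fps" where
  "hilbert_series = Abs_fps (\<lambda>i. real (dim (gr i)))"

definition weighted_polynomial_hilbert_series :: bool where
  "weighted_polynomial_hilbert_series \<longleftrightarrow>
     (\<exists>(m::nat) (n::nat \<Rightarrow> nat). m \<ge> 1 \<and>
        hilbert_series = (\<Prod>i = 1..m. 1 / (1 - fps_X ^ i) ^ n i))"

definition GKdim :: ereal where
  "GKdim = limsup (\<lambda>n. ereal (log (real n) (real (dim (span (\<Union>i\<le>n. gr i))))))"

definition finite_GKdim :: bool where
  "finite_GKdim \<longleftrightarrow>
     (\<exists>c>0. \<exists>e>0. \<forall>n\<ge>1. real (dim (gr n)) \<le> c * real n powr e)"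

text \<open>
  \<open>Hom\<^sub>A(P, A)\<close> consists of all left \<open>A\<close>-linear maps, not only those of degree 0.  To have a
  unique function for each map, elements are required to vanish off the carrier.  It is a right
  module by \<open>(f \<cdot> a) x = f x * a\<close>.
\<close>

definition Hom_A :: "'a umod \<Rightarrow> ((nat \<Rightarrow> 'a) \<Rightarrow> 'a) set" where
  "Hom_A P = {f. module_map P regular_module f \<and> (\<forall>x. x \<notin> carrier P \<longrightarrow> f x = 0)}"

definition cocycles ::
    "(nat \<Rightarrow> 'a umod) \<Rightarrow> (nat \<Rightarrow> (nat \<Rightarrow> 'a) \<Rightarrow> (nat \<Rightarrow> 'a)) \<Rightarrow> nat \<Rightarrow> ((nat \<Rightarrow> 'a) \<Rightarrow> 'a) set" where
  "cocycles P \<delta> q = {f \<in> Hom_A (P q). \<forall>x\<in>carrier (P (Suc q)). f (\<delta> q x) = 0}"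

fun coboundaries ::
    "(nat \<Rightarrow> 'a umod) \<Rightarrow> (nat \<Rightarrow> (nat \<Rightarrow> 'a) \<Rightarrow> (nat \<Rightarrow> 'a)) \<Rightarrow> nat \<Rightarrow> ((nat \<Rightarrow> 'a) \<Rightarrow> 'a) set" where
  "coboundaries P \<delta> 0 = {0}"
| "coboundaries P \<delta> (Suc q) =
     {f \<in> Hom_A (P (Suc q)). \<exists>g \<in> Hom_A (P q). \<forall>x\<in>carrier (P (Suc q)). f x = g (\<delta> q x)}"

definition ext_rel ::
    "(nat \<Rightarrow> 'a umod) \<Rightarrow> (nat \<Rightarrow> (nat \<Rightarrow> 'a) \<Rightarrow> (nat \<Rightarrow> 'a)) \<Rightarrow> nat \<Rightarrow>
     (((nat \<Rightarrow> 'a) \<Rightarrow> 'a) \<times> ((nat \<Rightarrow> 'a) \<Rightarrow> 'a)) set" where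
  "ext_rel P \<delta> q =
     {(f, g). f \<in> cocycles P \<delta> q \<and> g \<in> cocycles P \<delta> q \<and> f - g \<in> coboundaries P \<delta> q}"

definition Ext_A ::
    "(nat \<Rightarrow> 'a umod) \<Rightarrow> (nat \<Rightarrow> (nat \<Rightarrow> 'a) \<Rightarrow> (nat \<Rightarrow> 'a)) \<Rightarrow> nat \<Rightarrow> ((nat \<Rightarrow> 'a) \<Rightarrow> 'a) set set" where
  "Ext_A P \<delta> q = cocycles P \<delta> q // ext_rel P \<delta> q"

definition Ext_A_zero ::
    "(nat \<Rightarrow> 'a umod) \<Rightarrow> (nat \<Rightarrow> (nat \<Rightarrow> 'a) \<Rightarrow> (nat \<Rightarrow> 'a)) \<Rightarrow> nat \<Rightarrow> bool" where
  "Ext_A_zero P \<delta> q \<longleftrightarrow> Ext_A P \<delta> q = {ext_rel P \<delta> q `` {0}}"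

text \<open>
  Isomorphism of right \<open>A\<close>-modules with the trivial module; taking \<open>a = scale c 1\<close> shows that it
  includes linearity over the field.
\<close>

definition Ext_A_trivial ::
    "(nat \<Rightarrow> 'a umod) \<Rightarrow> (nat \<Rightarrow> (nat \<Rightarrow> 'a) \<Rightarrow> (nat \<Rightarrow> 'a)) \<Rightarrow> nat \<Rightarrow> bool" where
  "Ext_A_trivial P \<delta> q \<longleftrightarrow>
     (\<exists>\<phi>. bij_betw \<phi> (Ext_A P \<delta> q) (UNIV :: 'k set) \<and>
        (\<forall>f\<in>cocycles P \<delta> q. \<forall>g\<in>cocycles P \<delta> q.
           \<phi> (ext_rel P \<delta> q `` {f + g}) = \<phi> (ext_rel P \<delta> q `` {f}) + \<phi> (ext_rel P \<delta> q `` {g})) \<and>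
        (\<forall>f\<in>cocycles P \<delta> q. \<forall>a.
           \<phi> (ext_rel P \<delta> q `` {\<lambda>x. f x * a}) = \<phi> (ext_rel P \<delta> q `` {f}) * augmentation a))"

text \<open>
  Ext does not depend on the projective resolution of the trivial module, which always exists;
  the condition is imposed on every one of them.
\<close>

definition Gorenstein :: "nat \<Rightarrow> bool" where
  "Gorenstein d \<longleftrightarrow>
     (\<forall>P \<delta> e. projective_resolution trivial_module P \<delta> e \<longrightarrow>
        (\<forall>q. q \<noteq> d \<longrightarrow> Ext_A_zero P \<delta> q) \<and> Ext_A_trivial P \<delta> d)"

text \<open>Finite generation of the algebra is part of the conventions for graded algebras.\<close>

definition AS_regular :: "nat \<Rightarrow> bool" where
  "AS_regular d \<longleftrightarrow> gldim = enat d \<and> finite_GKdim \<and> Gorenstein d"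

end

end

theory Submission
  imports Defs "HOL-Computational_Algebra.Polynomial_FPS"
begin

text \<open>
  The terms of the minimal resolution of the trivial module are free, say on \<open>b j\<close> generators
  of degree \<open>\<nu> j = koszul_degree N j\<close>, because a projective graded module generated in a
  single degree is free (\<open>resolution_free\<close>).  Counting dimensions in the exact sequence, degree
  by degree, gives \<open>h(t) \<cdot> (\<Sum>j. (-1)^j b j t^(\<nu> j)) = 1\<close> for the Hilbert series \<open>h\<close>
  (\<open>resolution_euler_characteristic\<close>).  Where the resolution stops, Ext into the algebra is
  nonzero: by minimality the coboundaries take values in the augmentation ideal, while a coordinate
  of the last free module does not (\<open>Ext_top_nonzero\<close>).  Hence the Gorenstein condition makes
  \<open>d\<close> the last index.  With \<open>h(t) = (\<Prod>i. 1 / (1 - t^i)^(n i))\<close> this becomes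

    \<open>(\<Sum>j\<le>d. (-1)^j b j t^(\<nu> j)) = (\<Prod>i. (1 - t^i)^(n i))\<close>,

  and a GK dimension of \<open>d\<close> forces \<open>(\<Sum>i. n i) \<ge> d\<close>, as the algebra cannot grow faster than
  \<open>x^(\<Sum>i. n i)\<close> (\<open>GKdim_le\<close>).

  The rest is a statement about this polynomial identity, proved in the locale
  \<open>koszul_numerator\<close>.  The left side has at most \<open>d + 1\<close> terms and vanishes at \<open>1\<close> to order at
  least \<open>d\<close>.  A Vandermonde argument shows that all the \<open>b j\<close> are then nonzero and determined by
  the exponents; for instance \<open>b 1 = (\<Prod>j=2..d. \<nu> j / (\<nu> j - 1)) > 1\<close>.  The right side is
  palindromic up to sign, so the exponents are symmetric, and for \<open>N \<ge> 3\<close> this makes \<open>d\<close> odd.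
  Substituting \<open>t = exp x\<close> and comparing the first two nonzero Taylor coefficients gives the value
  of \<open>\<Sum>i. n i * i^2\<close>; together with \<open>\<Sum>i. n i\<close> and \<open>\<Sum>i. n i * i\<close> it shows that the weights
  \<open>i\<close> concentrate around \<open>N / 2\<close>:

    \<open>(\<Sum>i. n i * (2 * i - N)^2) < 2 * N * (N - 2)\<close>

  (\<open>exponents_concentrated\<close>).  On the other hand the gap between the exponents \<open>1\<close> and \<open>N\<close> forces
  many factors of small weight: \<open>n 1 = b 1 \<ge> 2\<close>, and \<open>n (N - 1) \<ge> 2\<close> if \<open>N \<ge> 4\<close>, as for the
  dimensions of a free Lie algebra.  The weights \<open>1\<close> and \<open>N - 1\<close> lie at the maximal distance from
  \<open>N / 2\<close> among those below \<open>N\<close>, and for \<open>N \<ge> 4\<close> their contribution alone reaches the bound.  For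
  \<open>N = 3\<close> the bound leaves only \<open>n 1 = 2\<close>, and the product formula for \<open>b 1\<close> then gives \<open>d = 3\<close>.
\<close>

section \<open>Substituting the exponential series\<close>

unbundle fps_syntax

text \<open>
  The series of \<open>p(exp x)\<close>.  Composition of power series needs an inner series without constant
  term, hence the shift of the variable by one.
\<close>

definition subst_exp :: "real poly \<Rightarrow> real fps" where
  "subst_exp p = fps_of_poly (pcompose p [:1, 1:]) oo (fps_exp 1 - 1)"

lemma subst_exp_mult: "subst_exp (p * q) = subst_exp p * subst_exp q"
  by (simp add: subst_exp_def pcompose_mult fps_of_poly_mult fps_compose_mult_distrib)

lemma subst_exp_diff: "subst_exp (p - q) = subst_exp p - subst_exp q"
  by (simp add: subst_exp_def pcompose_diff fps_of_poly_diff fps_compose_sub_distrib)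

lemma subst_exp_sum: "subst_exp (\<Sum>i\<in>A. f i) = (\<Sum>i\<in>A. subst_exp (f i))"
  by (simp add: subst_exp_def pcompose_sum fps_of_poly_sum fps_compose_sum_distrib)

lemma subst_exp_1: "subst_exp 1 = 1"
  by (simp add: subst_exp_def pcompose_1)

lemma subst_exp_power: "subst_exp (p ^ n) = subst_exp p ^ n"
  by (induction n) (simp_all add: subst_exp_1 subst_exp_mult)

lemma subst_exp_prod: "subst_exp (\<Prod>i\<in>A. f i) = (\<Prod>i\<in>A. subst_exp (f i))"
  by (induction A rule: infinite_finite_induct) (simp_all add: subst_exp_1 subst_exp_mult)

lemma subst_exp_monom: "subst_exp (monom c k) = fps_const c * fps_exp (real k)"
proof -
  have X: "subst_exp (monom 1 1) = fps_exp 1"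
  proof -
    have lin: "fps_of_poly [:1, 1::real:] = fps_X + 1"
      by (simp add: fps_of_poly_linear)
    show ?thesis
      by (simp add: subst_exp_def monom_altdef pcompose_pCons lin fps_compose_add_distrib)
  qed
  have C: "subst_exp [:c:] = fps_const c"
    by (simp add: subst_exp_def fps_of_poly_const)
  have "monom c k = [:c:] * monom 1 1 ^ k"
    by (simp add: monom_altdef)
  then show ?thesis
    by (simp only: subst_exp_mult subst_exp_power X C fps_exp_power_mult mult_1_right)
qed

text \<open>
  The next three lemmas follow the shape \<open>x^s * (k + k * a * x^2 + O(x^3))\<close> through products: the
  orders \<open>s\<close> and the relative second coefficients \<open>a\<close> add up.  The basic example is
  \<open>- 2 * sinh (a * x)\<close>.
\<close>

lemma fps_exp_odd_leading:
  fixes a :: real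
  shows "\<exists>H. fps_exp (- a) - fps_exp a = fps_X * H \<and> H $ 0 = - 2 * a \<and> H $ 1 = 0
    \<and> H $ 2 = H $ 0 * (a\<^sup>2 / 6)"
proof -
  let ?f = "fps_exp (- a) - fps_exp a"
  have "?f = fps_X * fps_shift 1 ?f"
    by (rule fps_ext) (auto simp: fps_X_mult_nth)
  moreover have "fps_shift 1 ?f $ 2 = fps_shift 1 ?f $ 0 * (a\<^sup>2 / 6)"
    by (simp add: numeral_eq_Suc fact_numeral field_simps)
  ultimately show ?thesis
    by (intro exI[of _ "fps_shift 1 ?f"]) (simp add: numeral_eq_Suc)
qed

lemma power_leading:
  fixes f :: "real fps"
  assumes "f = fps_X * H" "H $ 0 \<noteq> 0" "H $ 1 = 0" "H $ 2 = H $ 0 * a"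
  shows "\<exists>K. f ^ n = fps_X ^ n * K \<and> K $ 0 \<noteq> 0 \<and> K $ 1 = 0 \<and> K $ 2 = K $ 0 * (real n * a)"
proof (induction n)
  case 0
  show ?case by (intro exI[of _ 1]) auto
next
  case (Suc n)
  then obtain K where K: "f ^ n = fps_X ^ n * K" "K $ 0 \<noteq> 0" "K $ 1 = 0" "K $ 2 = K $ 0 * (real n * a)"
    by blast
  show ?case
    using assms K
    by (intro exI[of _ "H * K"])
      (auto simp: fps_mult_nth numeral_eq_Suc algebra_simps)
qed

lemma prod_leading:
  fixes f :: "nat \<Rightarrow> real fps"
  assumes "finite A" "\<And>i. i \<in> A \<Longrightarrow> \<exists>K. f i = fps_X ^ n i * K \<and> K $ 0 \<noteq> 0 \<and> K $ 1 = 0 \<and> K $ 2 = K $ 0 * a i"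
  shows "\<exists>K. (\<Prod>i\<in>A. f i) = fps_X ^ (\<Sum>i\<in>A. n i) * K \<and> K $ 0 \<noteq> 0 \<and> K $ 1 = 0
    \<and> K $ 2 = K $ 0 * (\<Sum>i\<in>A. a i)"
  using assms
proof (induction A rule: finite_induct)
  case empty
  show ?case by (intro exI[of _ 1]) auto
next
  case (insert x F)
  from insert obtain K where K: "(\<Prod>i\<in>F. f i) = fps_X ^ (\<Sum>i\<in>F. n i) * K" "K $ 0 \<noteq> 0" "K $ 1 = 0"
    "K $ 2 = K $ 0 * (\<Sum>i\<in>F. a i)" by auto
  from insert obtain H where H: "f x = fps_X ^ n x * H" "H $ 0 \<noteq> 0" "H $ 1 = 0" "H $ 2 = H $ 0 * a x"
    by blast
  show ?case
    using insert.hyps H K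
    by (intro exI[of _ "H * K"])
      (auto simp: fps_mult_nth numeral_eq_Suc algebra_simps power_add)
qed

text \<open>
  Centring the exponents at half the degree \<open>W\<close> turns each factor \<open>1 - exp(i x)\<close> into the odd
  function \<open>- 2 * sinh (i * x / 2)\<close>; this is what removes the coefficient next to the leading one.
\<close>

lemma exp_sum_leading:
  fixes c :: "nat \<Rightarrow> real" and n \<nu> :: "nat \<Rightarrow> nat" and M d :: nat
  assumes "(\<Sum>j\<le>d. monom (c j) (\<nu> j)) = (\<Prod>i=1..M. (1 - monom 1 i) ^ n i)"
  defines "W \<equiv> \<Sum>i=1..M. i * n i"
  shows "\<exists>K. (\<Sum>j\<le>d. fps_const (c j) * fps_exp (real (\<nu> j) - real W / 2))
    = fps_X ^ (\<Sum>i=1..M. n i) * K \<and> K $ 0 \<noteq> 0 \<and> K $ 1 = 0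
    \<and> K $ 2 = K $ 0 * (\<Sum>i=1..M. real (n i) * (real i)\<^sup>2 / 24)"
proof -
  have "(\<Sum>j\<le>d. fps_const (c j) * fps_exp (real (\<nu> j) - real W / 2))
      = (\<Sum>j\<le>d. fps_const (c j) * fps_exp (real (\<nu> j))) * fps_exp (- real W / 2)"
    by (simp add: sum_distrib_right mult.assoc flip: fps_exp_add_mult)
  also have "(\<Sum>j\<le>d. fps_const (c j) * fps_exp (real (\<nu> j))) = subst_exp (\<Sum>j\<le>d. monom (c j) (\<nu> j))"
    by (simp add: subst_exp_sum subst_exp_monom)
  also have "\<dots> = (\<Prod>i=1..M. (1 - fps_exp (real i)) ^ n i)"
    unfolding assms(1)
    by (simp add: subst_exp_prod subst_exp_power subst_exp_diff subst_exp_1 subst_exp_monom)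
  also have "fps_exp (- real W / 2) = (\<Prod>i=1..M. fps_exp (- real i / 2) ^ n i)"
  proof -
    have "(\<Prod>i\<in>A. fps_exp (- real i / 2) ^ n i) = fps_exp (- real (\<Sum>i\<in>A. i * n i) / 2)" if "finite A" for A
      using that
      by (induction A rule: finite_induct)
        (auto simp: fps_exp_power_mult algebra_simps add_divide_distrib diff_divide_distrib simp flip: fps_exp_add_mult)
    then show ?thesis by (simp add: W_def)
  qed
  also have "(\<Prod>i=1..M. (1 - fps_exp (real i)) ^ n i) * (\<Prod>i=1..M. fps_exp (- real i / 2) ^ n i)
      = (\<Prod>i=1..M. (fps_exp (- (real i / 2)) - fps_exp (real i / 2)) ^ n i)"
    unfolding prod.distrib[symmetric] power_mult_distrib[symmetric]
    by (simp add: algebra_simps flip: fps_exp_add_mult)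
  finally have eq: "(\<Sum>j\<le>d. fps_const (c j) * fps_exp (real (\<nu> j) - real W / 2))
     = (\<Prod>i=1..M. (fps_exp (- (real i / 2)) - fps_exp (real i / 2)) ^ n i)" .
  have "\<exists>K. (fps_exp (- (real i / 2)) - fps_exp (real i / 2)) ^ n i = fps_X ^ n i * K \<and> K $ 0 \<noteq> 0 \<and> K $ 1 = 0
    \<and> K $ 2 = K $ 0 * (real (n i) * (real i)\<^sup>2 / 24)" if "i \<in> {1..M}" for i
  proof -
    from fps_exp_odd_leading[of "real i / 2"] obtain H where H:
      "fps_exp (- (real i / 2)) - fps_exp (real i / 2) = fps_X * H" "H $ 0 = - 2 * (real i / 2)" "H $ 1 = 0"
      "H $ 2 = H $ 0 * ((real i / 2)\<^sup>2 / 6)" by blast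
    have "H $ 0 \<noteq> 0" using that H(2) by simp
    from power_leading[OF H(1) this H(3,4), of "n i"] show ?thesis
      by (simp add: power_divide)
  qed
  then show ?thesis
    unfolding eq by (intro prod_leading) auto
qed

text \<open>
  The Taylor coefficients of an exponential sum are the moments of its weighted nodes, so a
  vanishing order of the sum annihilates all polynomials of smaller degree.
\<close>

lemma exp_sum_moments:
  fixes c y :: "nat \<Rightarrow> real"
  assumes "finite A"
  defines "G \<equiv> \<Sum>j\<in>A. fps_const (c j) * fps_exp (y j)"
  shows "(\<Sum>j\<in>A. c j * poly q (y j)) = (\<Sum>k\<le>degree q. coeff q k * fact k * G $ k)"
proof -
  have "(\<Sum>k\<le>degree q. coeff q k * fact k * G $ k)
    = (\<Sum>k\<le>degree q. \<Sum>j\<in>A. c j * (coeff q k * y j ^ k))"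
    by (simp add: G_def fps_sum_nth sum_distrib_left mult_ac)
  also have "\<dots> = (\<Sum>j\<in>A. c j * poly q (y j))"
    by (subst sum.swap) (simp add: poly_altdef sum_distrib_left)
  finally show ?thesis ..
qed

text \<open>
  The nodes of the centred sum come in pairs \<open>\<plusminus>z\<close>, and these are the top coefficients of the
  polynomial that vanishes on them.
\<close>

lemma even_node_poly:
  fixes z :: "nat \<Rightarrow> real"
  defines "Q \<equiv> \<lambda>m. \<Prod>k<m. [:- (z k)\<^sup>2, 0, 1:]"
  shows "degree (Q m) = 2 * m \<and> coeff (Q m) (2 * m) = 1
    \<and> (m > 0 \<longrightarrow> coeff (Q m) (2 * m - 1) = 0 \<and> coeff (Q m) (2 * m - 2) = - (\<Sum>k<m. (z k)\<^sup>2))"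
proof (induction m)
  case 0
  show ?case by (simp add: Q_def)
next
  case (Suc m)
  have Q: "Q (Suc m) = [:- (z m)\<^sup>2, 0, 1:] * Q m"
    by (simp add: Q_def mult.commute)
  have ex: "[:- (z m)\<^sup>2, 0, 1:] * Q m = smult (- (z m)\<^sup>2) (Q m) + pCons 0 (pCons 0 (Q m))"
    by simp
  have hi: "coeff (Q m) k = 0" if "k > 2 * m" for k
    using Suc that by (intro coeff_eq_0) auto
  have Q0: "Q 0 = 1" by (simp add: Q_def)
  have nz: "Q m \<noteq> 0" using Suc by (metis coeff_0 zero_neq_one)
  have "degree (Q (Suc m)) = 2 * Suc m"
    unfolding Q using Suc nz by (subst degree_mult_eq) auto
  moreover have "coeff (Q (Suc m)) (2 * Suc m) = 1"
    unfolding Q ex using Suc by (simp add: hi)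
  moreover have "coeff (Q (Suc m)) (2 * Suc m - 1) = 0"
    unfolding Q ex using Suc hi by (cases m) (auto simp: Q0)
  moreover have "coeff (Q (Suc m)) (2 * Suc m - 2) = - (\<Sum>k<Suc m. (z k)\<^sup>2)"
    unfolding Q ex using Suc hi by (cases m) (auto simp: Q0)
  ultimately show ?case by simp
qed

section \<open>Products of factors with a gap after the linear term\<close>

text \<open>
  This is the series \<open>x^i / (1 - x^i)\<close>, whose multiples by \<open>- i\<close> are the logarithmic derivatives
  \<open>x * f' / f\<close> of \<open>f = 1 - x^i\<close>.
\<close>

definition divisor_fps :: "nat \<Rightarrow> real fps" where
  "divisor_fps i = Abs_fps (\<lambda>k. if k > 0 \<and> i dvd k then 1 else 0)"

lemma divisor_fps_eq:
  assumes "i > 0"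
  shows "(1 - fps_X ^ i) * divisor_fps i = fps_X ^ i"
proof (rule fps_ext)
  fix k
  show "((1 - fps_X ^ i) * divisor_fps i) $ k = (fps_X ^ i :: real fps) $ k"
    using assms
    by (auto simp: left_diff_distrib fps_X_power_mult_nth divisor_fps_def fps_X_power_nth dvd_minus_self
        dest: dvd_imp_le)
qed

lemma log_deriv_factor:
  assumes "i > 0"
  shows "fps_X * fps_deriv ((1 - fps_X ^ i) ^ n) = - ((1 - fps_X ^ i) ^ n * (fps_const (real (n * i)) * divisor_fps i))"
proof (induction n)
  case 0
  show ?case by simp
next
  case (Suc n)
  let ?u = "1 - fps_X ^ i :: real fps"
  have d: "fps_X * fps_deriv ?u = - (fps_const (real i) * (?u * divisor_fps i))"
    unfolding divisor_fps_eq[OF assms]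
    using assms by (intro fps_ext) (auto simp: algebra_simps simp del: fps_deriv_power)
  have "fps_X * fps_deriv (?u ^ Suc n) = (fps_X * fps_deriv ?u) * ?u ^ n + ?u * (fps_X * fps_deriv (?u ^ n))"
    by (simp add: algebra_simps)
  also have "\<dots> = - (?u ^ Suc n * (fps_const (real (Suc n * i)) * divisor_fps i))"
    unfolding Suc d
    by (simp add: algebra_simps fps_const_add[symmetric] del: fps_const_add)
  finally show ?case .
qed

lemma log_deriv_prod:
  assumes "finite A" "\<And>i. i \<in> A \<Longrightarrow> i > 0"
  shows "fps_X * fps_deriv (\<Prod>i\<in>A. (1 - fps_X ^ i) ^ n i)
    = - ((\<Prod>i\<in>A. (1 - fps_X ^ i) ^ n i) * (\<Sum>i\<in>A. fps_const (real (n i * i)) * divisor_fps i))"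
  using assms
proof (induction A rule: finite_induct)
  case empty
  show ?case by simp
next
  case (insert x F)
  let ?f = "(1 - fps_X ^ x) ^ n x :: real fps" and ?g = "\<Prod>i\<in>F. (1 - fps_X ^ i) ^ n i :: real fps"
  have "fps_X * fps_deriv (?f * ?g) = (fps_X * fps_deriv ?f) * ?g + ?f * (fps_X * fps_deriv ?g)"
    by (simp add: algebra_simps)
  also have "\<dots> = - (?f * ?g * (fps_const (real (n x * x)) * divisor_fps x + (\<Sum>i\<in>F. fps_const (real (n i * i)) * divisor_fps i)))"
    using insert log_deriv_factor[of x "n x"] by (simp add: algebra_simps)
  finally show ?case using insert by simp
qed

text \<open>
  In degrees below \<open>N\<close> the product is \<open>1 - b x\<close>, so its logarithmic derivative agrees there with
  \<open>- b x / (1 - b x)\<close>, which has coefficients \<open>- b ^ k\<close>.  The recursion in the proof compares coefficients.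
\<close>

lemma divisor_power_sums:
  fixes f :: "real fps"
  assumes f: "f = (\<Prod>i=1..M. (1 - fps_X ^ i) ^ n i)"
    and f1: "f $ 1 = - b" and gap: "\<And>j. 2 \<le> j \<Longrightarrow> j < N \<Longrightarrow> f $ j = 0"
    and k: "1 \<le> k" "k < N"
  shows "(\<Sum>i | i \<in> {1..M} \<and> i dvd k. real (n i * i)) = b ^ k"
proof -
  define s where "s = (\<Sum>i=1..M. fps_const (real (n i * i)) * divisor_fps i)"
  have s: "s $ k = (\<Sum>i | i \<in> {1..M} \<and> i dvd k. real (n i * i))" if "k > 0" for k
    using that by (auto simp: s_def fps_sum_nth divisor_fps_def if_distrib sum.If_cases Int_def cong: if_cong)
  have s0: "s $ 0 = 0"
    by (auto simp: s_def fps_sum_nth divisor_fps_def)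
  have f0: "f $ 0 = 1"
  proof -
    have "(\<Prod>i\<in>A. (1 - fps_X ^ i) ^ n i :: real fps) $ 0 = 1" if "finite A" "\<forall>i\<in>A. i > 0" for A
      using that
    proof (induction A rule: finite_induct)
      case (insert x F)
      then show ?case by (cases x) (simp_all add: fps_power_zeroth)
    qed simp
    then show ?thesis by (simp add: f)
  qed
  have fs: "fps_X * fps_deriv f = - (f * s)"
    unfolding f s_def by (rule log_deriv_prod) auto
  have rec: "real k * f $ k = - (\<Sum>j=0..k. f $ j * s $ (k - j))" if "k > 0" for k
  proof -
    have "(fps_X * fps_deriv f) $ k = real k * f $ k"
      using that by (simp del: of_nat_Suc)
    then show ?thesis unfolding fs by (simp add: fps_mult_nth)
  qed
  have sk: "k < N \<longrightarrow> s $ k = b ^ k" if "k \<ge> 1" for k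
    using that
  proof (induction k rule: dec_induct)
    case base
    show ?case using rec[of 1] f0 f1 s0 by simp
  next
    case (step k)
    show ?case
    proof
      assume kN: "Suc k < N"
      have sub: "{0, 1} \<subseteq> {0..Suc k}" by auto
      have "(\<Sum>j=0..Suc k. f $ j * s $ (Suc k - j)) = (\<Sum>j\<in>{0,1}. f $ j * s $ (Suc k - j))"
        using kN gap by (intro sum.mono_neutral_right[OF _ sub]) auto
      also have "\<dots> = s $ Suc k - b * s $ k" using f0 f1 by simp
      finally have "s $ Suc k = b * s $ k"
        using rec[of "Suc k"] gap[of "Suc k"] step kN by simp
      then show "s $ Suc k = b ^ Suc k" using step kN by simp
    qed
  qed
  show ?thesis using sk s k by simp
qed

text \<open>
  Let \<open>k = N - 1\<close>.  By the formula for the divisor sums, \<open>k * n k\<close> is \<open>b ^ k\<close> up to the contribution of the proper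
  divisors of \<open>k\<close>.  For \<open>k \<ge> 3\<close> these are at most \<open>k - 2\<close>, and the geometric sum of the
  \<open>b ^ i\<close> with \<open>i \<le> k - 2\<close> is less than \<open>b ^ (k - 1)\<close>.  What remains is greater than \<open>k\<close>.
\<close>

lemma exponent_lower_bound:
  fixes n :: "nat \<Rightarrow> nat" and b :: nat
  assumes sums: "\<And>k. 1 \<le> k \<Longrightarrow> k < N \<Longrightarrow> (\<Sum>i | i \<in> {1..M} \<and> i dvd k. n i * i) = b ^ k"
    and b: "b \<ge> 2" and NM: "N \<le> M" and N: "N \<ge> 4"
  shows "n (N - 1) \<ge> 2"
proof -
  define k where "k = N - 1"
  have k: "k \<ge> 3" "k < N" "k \<le> M" using N NM by (auto simp: k_def)
  have le: "n i * i \<le> b ^ i" if "1 \<le> i" "i < N" for i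
  proof -
    have "n i * i \<le> (\<Sum>j | j \<in> {1..M} \<and> j dvd i. n j * j)"
      using that NM by (intro member_le_sum) auto
    then show ?thesis using sums that by simp
  qed
  have geo: "(\<Sum>i=1..j. b ^ i) + b \<le> b ^ Suc j" for j
  proof (induction j)
    case (Suc j)
    have "2 * b ^ Suc j \<le> b ^ Suc (Suc j)"
      using b mult_right_mono[of 2 b "b ^ Suc j"] by simp
    moreover have "(\<Sum>i=1..Suc j. b ^ i) = (\<Sum>i=1..j. b ^ i) + b ^ Suc j" by simp
    ultimately show ?case using Suc by linarith
  qed simp
  have split: "{i. i \<in> {1..M} \<and> i dvd k} \<subseteq> insert k {1..k-2}"
  proof
    fix i assume "i \<in> {i. i \<in> {1..M} \<and> i dvd k}"
    then obtain q where q: "k = i * q" "i \<ge> 1" by auto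
    show "i \<in> insert k {1..k-2}"
    proof (cases "q \<le> 1")
      case True then show ?thesis using q k by (cases q) auto
    next
      case False
      then have "2 * i \<le> k" using q by (simp add: mult.commute)
      then show ?thesis using q(2) k by auto
    qed
  qed
  have "b ^ k = (\<Sum>i | i \<in> {1..M} \<and> i dvd k. n i * i)" using sums k by simp
  also have "\<dots> \<le> (\<Sum>i\<in>insert k {1..k-2}. n i * i)"
    by (intro sum_mono2 split) auto
  also have "\<dots> = n k * k + (\<Sum>i=1..k-2. n i * i)" using k by (subst sum.insert) auto
  also have "(\<Sum>i=1..k-2. n i * i) \<le> (\<Sum>i=1..k-2. b ^ i)"
    using k by (intro sum_mono le) auto
  finally have 1: "b ^ k \<le> n k * k + (\<Sum>i=1..k-2. b ^ i)" by simp
  have "(\<Sum>i=1..k-2. b ^ i) + b \<le> b ^ (k - 1)"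
    using geo[of "k - 2"] k by (simp add: numeral_eq_Suc Suc_diff_Suc)
  moreover have "2 * b ^ (k - 1) \<le> b ^ k"
    using b k by (cases k) (auto intro: mult_right_mono)
  ultimately have "b ^ (k - 1) + 2 \<le> n k * k" using 1 b by linarith
  moreover have "k \<le> 2 ^ (k - 1)"
  proof -
    have "j + 3 \<le> 2 ^ (j + 2)" for j :: nat by (induction j) auto
    from this[of "k - 3"] show ?thesis using k(1) by (simp add: numeral_eq_Suc Suc_diff_Suc)
  qed
  moreover have "(2::nat) ^ (k - 1) \<le> b ^ (k - 1)" using b by (intro power_mono) auto
  ultimately have "k < n k * k" by linarith
  then have "n k \<noteq> 0" "n k \<noteq> 1" by (auto intro!: notI)
  then show ?thesis by (simp add: k_def)
qed

section \<open>Sparse polynomials that are products of factors one minus a power\<close>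

text \<open>
  The polynomial identity left over from the algebra.  Factors with exponent \<open>n i = 0\<close> may be added
  freely, so \<open>N \<le> M\<close> only ensures that \<open>N - 1\<close> is one of the indices.
\<close>

locale koszul_numerator =
  fixes N d M :: nat and \<nu> b n :: "nat \<Rightarrow> nat"
  assumes N: "N \<ge> 3" and d: "d \<ge> 2" and NM: "N \<le> M"
    and \<nu>_even: "\<And>k. \<nu> (2 * k) = k * N" and \<nu>_odd: "\<And>k. \<nu> (Suc (2 * k)) = k * N + 1"
    and factorization:
      "(\<Sum>j\<le>d. monom ((-1) ^ j * real (b j)) (\<nu> j)) = (\<Prod>i=1..M. (1 - monom 1 i) ^ n i)"
    and order: "d \<le> (\<Sum>i=1..M. n i)"
begin

text \<open>
  \<open>W\<close> is the degree of the product, and \<open>y\<close> lists the exponents centred at \<open>W / 2\<close>.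
\<close>

definition p :: "real poly" where "p = (\<Sum>j\<le>d. monom ((-1) ^ j * real (b j)) (\<nu> j))"
definition W :: nat where "W = (\<Sum>i=1..M. i * n i)"
definition y :: "nat \<Rightarrow> real" where "y j = real (\<nu> j) - real W / 2"
definition c :: "nat \<Rightarrow> real" where "c j = (-1) ^ j * real (b j)"

lemma p_eq_product: "p = (\<Prod>i=1..M. (1 - monom 1 i) ^ n i)"
  by (simp add: p_def factorization)

lemma \<nu>_strict: "strict_mono \<nu>"
proof (rule strict_mono_Suc_iff[THEN iffD2], intro allI)
  fix j
  show "\<nu> j < \<nu> (Suc j)"
  proof (cases "even j")
    case True
    then obtain k where "j = 2 * k" by auto
    then show ?thesis by (simp add: \<nu>_even \<nu>_odd)
  next
    case False
    then obtain k where "j = Suc (2 * k)" using oddE by fastforce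
    then show ?thesis using N \<nu>_even[of "Suc k"] by (simp add: \<nu>_odd)
  qed
qed

lemma \<nu>_eq_iff: "\<nu> i = \<nu> j \<longleftrightarrow> i = j"
  using \<nu>_strict by (simp add: strict_mono_eq)

lemma \<nu>_less_iff: "\<nu> i < \<nu> j \<longleftrightarrow> i < j"
  using \<nu>_strict by (simp add: strict_mono_less)

lemma \<nu>_small: "\<nu> 0 = 0" "\<nu> (Suc 0) = 1" "\<nu> 2 = N" "\<nu> 3 = N + 1"
  using \<nu>_even[of 0] \<nu>_odd[of 0] \<nu>_even[of 1] \<nu>_odd[of 1] by (simp_all add: numeral_eq_Suc)

lemma coeff_p: "j \<le> d \<Longrightarrow> coeff p (\<nu> j) = c j"
  by (simp add: p_def coeff_sum \<nu>_eq_iff c_def)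

lemma coeff_p_gap: "k \<notin> \<nu> ` {..d} \<Longrightarrow> coeff p k = 0"
  by (auto simp: p_def coeff_sum intro!: sum.neutral)

lemma b_0_eq_1: "b 0 = 1"
proof -
  have "poly p 0 = 1"
    by (simp add: p_eq_product poly_prod poly_power poly_monom zero_power)
  then have "c 0 = 1" using coeff_p[of 0] by (simp add: poly_0_coeff_0 \<nu>_small)
  then show ?thesis by (simp add: c_def)
qed

lemma exp_leading:
  obtains K where
    "(\<Sum>j\<le>d. fps_const (c j) * fps_exp (y j)) = fps_X ^ (\<Sum>i=1..M. n i) * K" "K $ 0 \<noteq> 0" "K $ 1 = 0"
    "K $ 2 = K $ 0 * (\<Sum>i=1..M. real (n i) * (real i)\<^sup>2 / 24)"
  using exp_sum_leading[OF factorization] unfolding y_def W_def c_def by blast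

lemma moment_zero:
  assumes "degree q < (\<Sum>i=1..M. n i)"
  shows "(\<Sum>j\<le>d. c j * poly q (y j)) = 0"
proof -
  obtain K where K: "(\<Sum>j\<le>d. fps_const (c j) * fps_exp (y j)) = fps_X ^ (\<Sum>i=1..M. n i) * K"
    using exp_leading by blast
  show ?thesis
    unfolding exp_sum_moments[OF finite_atMost] K
    using assms by (auto simp: fps_X_power_mult_nth intro!: sum.neutral)
qed

text \<open>
  Choosing a polynomial that vanishes at all nodes but a few isolates the corresponding
  coefficients: with one node left over the coefficient must vanish, with two left over their ratio
  is determined.
\<close>

lemma sum_over_complement_of_nodes:
  assumes "A \<subseteq> {..d}" "card A < (\<Sum>i=1..M. n i)"
  shows "(\<Sum>j\<in>{..d} - A. c j * (\<Prod>i\<in>A. real (\<nu> j) - real (\<nu> i))) = 0"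
proof -
  have fin: "finite A" using assms(1) finite_subset by blast
  define q where "q = (\<Prod>i\<in>A. [:- y i, 1:])"
  have "degree q = card A"
    unfolding q_def by (subst degree_prod_eq_sum_degree) (auto simp: fin)
  then have "(\<Sum>j\<le>d. c j * poly q (y j)) = 0"
    using moment_zero assms by simp
  moreover have "poly q (y j) = (\<Prod>i\<in>A. real (\<nu> j) - real (\<nu> i))" for j
    by (simp add: q_def poly_prod y_def)
  ultimately have "(\<Sum>j\<le>d. c j * (\<Prod>i\<in>A. real (\<nu> j) - real (\<nu> i))) = 0" by simp
  moreover have "(\<Sum>j\<in>{..d} - A. c j * (\<Prod>i\<in>A. real (\<nu> j) - real (\<nu> i)))
      = (\<Sum>j\<le>d. c j * (\<Prod>i\<in>A. real (\<nu> j) - real (\<nu> i)))"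
    using assms(1) fin by (intro sum.mono_neutral_left) (auto intro: prod_zero)
  ultimately show ?thesis by simp
qed

text \<open>
  A higher order of vanishing would isolate the coefficient \<open>c 0 = 1\<close>.
\<close>

lemma vanishing_order_eq_d: "(\<Sum>i=1..M. n i) = d"
proof (rule ccontr)
  assume "(\<Sum>i=1..M. n i) \<noteq> d"
  then have "(\<Sum>j\<in>{..d} - {1..d}. c j * (\<Prod>i=1..d. real (\<nu> j) - real (\<nu> i))) = 0"
    using order by (intro sum_over_complement_of_nodes) auto
  moreover have "{..d} - {1..d} = {0}" by auto
  ultimately have "c 0 * (\<Prod>i=1..d. real (\<nu> 0) - real (\<nu> i)) = 0" by simp
  then show False using b_0_eq_1 by (auto simp: c_def \<nu>_eq_iff)
qed

lemma b_d_nonzero: "b d \<noteq> 0"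
proof
  assume *: "b d = 0"
  have "(\<Sum>j\<in>{..d} - {1..<d}. c j * (\<Prod>i=1..<d. real (\<nu> j) - real (\<nu> i))) = 0"
    using order d by (intro sum_over_complement_of_nodes) auto
  moreover have "{..d} - {1..<d} = {0, d}" using d by auto
  ultimately have "c 0 * (\<Prod>i=1..<d. real (\<nu> 0) - real (\<nu> i)) = 0"
    using * d by (simp add: c_def)
  then show False using b_0_eq_1 by (auto simp: c_def \<nu>_eq_iff)
qed

lemma b_1_product_formula: "real (b 1) * (\<Prod>i=2..d. real (\<nu> i) - 1) = (\<Prod>i=2..d. real (\<nu> i))"
proof -
  have "(\<Sum>j\<in>{..d} - {2..d}. c j * (\<Prod>i=2..d. real (\<nu> j) - real (\<nu> i))) = 0"
    using order d by (intro sum_over_complement_of_nodes) auto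
  moreover have "{..d} - {2..d} = {0, 1}" using d by auto
  moreover have "(\<Prod>i=2..d. - f i) = (-1) ^ (d - 1) * (\<Prod>i=2..d. f i)" for f :: "nat \<Rightarrow> real"
    using prod.distrib[of "\<lambda>_. -1" f "{2..d}"] by simp
  from this[of "\<lambda>i. real (\<nu> i)"] this[of "\<lambda>i. real (\<nu> i) - 1"]
  have "(\<Prod>i=2..d. real (\<nu> 0) - real (\<nu> i)) = (-1) ^ (d - 1) * (\<Prod>i=2..d. real (\<nu> i))"
    "(\<Prod>i=2..d. real (\<nu> 1) - real (\<nu> i)) = (-1) ^ (d - 1) * (\<Prod>i=2..d. real (\<nu> i) - 1)"
    by (simp_all add: \<nu>_small)
  ultimately show ?thesis using b_0_eq_1 by (simp add: c_def)
qed

lemma \<nu>_ge: "i \<ge> 2 \<Longrightarrow> \<nu> i \<ge> 3"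
  using \<nu>_less_iff[of 2 i] \<nu>_small(3) N by (cases "i = 2") auto

lemma b_1_ge: "b 1 \<ge> 2"
proof -
  have pos: "(\<Prod>i=2..d. real (\<nu> i) - 1) > 0"
    using \<nu>_ge by (intro prod_pos) force
  have "(\<Prod>i=2..d. real (\<nu> i) - 1) < (\<Prod>i=2..d. real (\<nu> i))"
    using d \<nu>_ge by (intro prod_mono_strict) force+
  then have "1 * (\<Prod>i=2..d. real (\<nu> i) - 1) < real (b 1) * (\<Prod>i=2..d. real (\<nu> i) - 1)"
    using b_1_product_formula by simp
  then show ?thesis using pos by (simp only: mult_less_cancel_right) auto
qed

text \<open>
  For \<open>N = 3\<close> the first two factors of the product formula for \<open>b 1\<close> are \<open>3 / 2\<close> and \<open>4 / 3\<close>, with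
  product \<open>2\<close> already, and every further factor is greater than one.
\<close>

lemma d_eq_3_of_b_1_eq_2:
  assumes "N = 3" "b 1 = 2" "odd d"
  shows "d = 3"
proof (rule ccontr)
  assume "d \<noteq> 3"
  then have d4: "d \<ge> 4" using d assms(3) by (cases "d = 2") auto
  have *: "{2..d} = insert 2 (insert 3 {4..d})" using d4 by auto
  have ge: "real (\<nu> i) \<ge> 3" if "i \<in> {4..d}" for i
    using \<nu>_ge[of i] that by simp
  have "(\<Prod>i=4..d. real (\<nu> i) - 1) < (\<Prod>i=4..d. real (\<nu> i))"
    using d4 by (intro prod_mono_strict) (use ge in force)+
  moreover have "real (b 1) * (2 * (3 * (\<Prod>i=4..d. real (\<nu> i) - 1))) = 3 * (4 * (\<Prod>i=4..d. real (\<nu> i)))"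
    using b_1_product_formula unfolding * by (simp add: assms(1) \<nu>_small)
  ultimately show False unfolding assms(2) by simp
qed

lemma degree_factor: "i \<ge> 1 \<Longrightarrow> degree (1 - monom 1 i :: real poly) = i"
  by (intro antisym degree_le le_degree) (auto simp: coeff_eq_0)

lemma degree_p: "degree p = \<nu> d"
proof (intro antisym degree_le le_degree)
  show "\<forall>i>\<nu> d. coeff p i = 0"
    using \<nu>_less_iff by (intro allI impI coeff_p_gap) (auto simp: not_le)
  show "coeff p (\<nu> d) \<noteq> 0" using coeff_p[of d] b_d_nonzero by (simp add: c_def)
qed

lemma W_eq_top_degree: "W = \<nu> d"
proof -
  have nz: "1 - monom 1 i \<noteq> (0 :: real poly)" if "i \<in> {1..M}" for i
    using degree_factor[of i] that by (metis atLeastAtMost_iff degree_0 not_one_le_zero)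
  have "degree p = W"
    unfolding p_eq_product W_def using nz degree_factor
    by (subst degree_prod_eq_sum_degree) (auto simp: degree_power_eq mult.commute intro!: sum.cong)
  then show ?thesis using degree_p by simp
qed

lemma palindromic: "k \<le> W \<Longrightarrow> coeff p (W - k) = (-1) ^ d * coeff p k"
proof -
  assume k: "k \<le> W"
  have deg: "degree p = W"
    using W_eq_top_degree degree_p by simp
  have r: "reflect_poly (1 - monom 1 i) = - 1 * (1 - monom 1 i :: real poly)" if "i \<ge> 1" for i
  proof (rule poly_eqI)
    fix k
    show "coeff (reflect_poly (1 - monom 1 i)) k = coeff (- 1 * (1 - monom 1 i :: real poly)) k"
      using that by (auto simp: coeff_reflect_poly degree_factor)
  qed
  have "reflect_poly p = (\<Prod>i=1..M. (- 1) ^ n i * (1 - monom 1 i) ^ n i)"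
    unfolding p_eq_product reflect_poly_prod reflect_poly_power
    by (intro prod.cong) (auto simp: r simp flip: power_mult_distrib)
  also have "\<dots> = (- 1) ^ d * p"
    unfolding prod.distrib power_sum[symmetric] vanishing_order_eq_d p_eq_product ..
  finally have "coeff (reflect_poly p) k = coeff ((- 1) ^ d * p) k" by simp
  moreover have "(- 1 :: real poly) ^ d * p = smult ((-1) ^ d) p"
    by (cases "even d") auto
  ultimately show ?thesis using k deg by (simp add: coeff_reflect_poly)
qed

text \<open>
  By symmetry \<open>\<nu> d - 1\<close> is an exponent, since \<open>1\<close> is.  If \<open>d\<close> were even, \<open>\<nu> d\<close> would be a multiple
  of \<open>N\<close>; but all exponents are \<open>0\<close> or \<open>1\<close> modulo \<open>N\<close>.
\<close>

lemma odd_d: "odd d"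
proof
  assume "even d"
  then obtain k where k: "d = 2 * k" "k \<ge> 1" using d by auto
  have W: "W = k * N" using W_eq_top_degree k by (simp add: \<nu>_even)
  have "1 \<le> W" using W N k(2) by (cases k) auto
  then have "coeff p (W - 1) \<noteq> 0"
    using palindromic[of 1] coeff_p[of 1] d b_1_ge by (simp add: \<nu>_small c_def)
  then obtain j where j: "W - 1 = \<nu> j" using coeff_p_gap by blast
  show False
  proof (cases "even j")
    case True
    then obtain l where l: "j = 2 * l" by auto
    have e: "k * N = l * N + 1" using j \<open>1 \<le> W\<close> unfolding l W \<nu>_even by linarith
    have "N dvd l * N + 1" unfolding e[symmetric] by simp
    then have "N dvd 1" using dvd_add_right_iff[of N "l * N" 1] by simp
    then show False using N by simp
  next
    case False
    then obtain l where l: "j = Suc (2 * l)" using oddE by fastforce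
    have e: "k * N = l * N + 2" using j \<open>1 \<le> W\<close> unfolding l W \<nu>_odd by linarith
    have "N dvd l * N + 2" unfolding e[symmetric] by simp
    then have "N dvd 2" using dvd_add_right_iff[of N "l * N" 2] by simp
    then show False using N dvd_imp_le[of N 2] by simp
  qed
qed

text \<open>
  The centred exponents are the numbers \<open>\<plusminus>z k\<close> with \<open>z k = k * N - W / 2\<close>.  Let \<open>Q\<close> be the product
  of the \<open>y^2 - (z k)^2\<close>.  The moment of \<open>y * Q\<close> is zero as \<open>Q\<close> vanishes on the nodes; on the other
  hand it is a combination of the Taylor coefficients of order \<open>d\<close> and \<open>d + 2\<close> of the exponential
  sum, whose ratio is \<open>(\<Sum>i. n i * i^2) / 24\<close>.
\<close>

lemma second_moment:
  assumes m: "d = 2 * m + 1"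
  shows "(2 * real m + 3) * (\<Sum>i=1..M. real (n i) * (real i)\<^sup>2)
    = (real N)\<^sup>2 * real m * (real m + 2) + 3"
proof -
  define z where "z k = real k * real N - real W / 2" for k
  have W: "W = m * N + 1" using W_eq_top_degree m by (simp add: \<nu>_odd)
  define Q where "Q = (\<Prod>k<Suc m. [:- (z k)\<^sup>2, 0, 1:])"
  have Q: "degree Q = d + 1" "coeff Q (d + 1) = 1" "coeff Q d = 0"
    "coeff Q (d - 1) = - (\<Sum>k<Suc m. (z k)\<^sup>2)"
    using even_node_poly[where z = z and m = "Suc m"] unfolding Q_def m by simp_all
  have root: "poly Q (y j) = 0" if "j \<le> d" for j
  proof -
    have "\<exists>k<Suc m. (y j)\<^sup>2 = (z k)\<^sup>2"
    proof (cases "even j")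
      case True
      then obtain k where "j = 2 * k" by auto
      then show ?thesis using that m by (intro exI[of _ k]) (auto simp: y_def z_def \<nu>_even)
    next
      case False
      then obtain k where k: "j = Suc (2 * k)" using oddE by fastforce
      then have "k \<le> m" using that m by simp
      then have "y j = - z (m - k)"
        unfolding k y_def z_def \<nu>_odd W by (simp add: of_nat_diff field_simps)
      then show ?thesis by (intro exI[of _ "m - k"]) auto
    qed
    then obtain k where k: "k \<in> {..<Suc m}" "poly [:- (z k)\<^sup>2, 0, 1:] (y j) = 0"
      by (auto simp: power2_eq_square)
    then show ?thesis unfolding Q_def poly_prod by (intro prod_zero bexI[of _ k] k) simp
  qed
  obtain K where K: "(\<Sum>j\<le>d. fps_const (c j) * fps_exp (y j)) = fps_X ^ d * K" "K $ 0 \<noteq> 0" "K $ 1 = 0"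
    "K $ 2 = K $ 0 * (\<Sum>i=1..M. real (n i) * (real i)\<^sup>2 / 24)"
    using exp_leading unfolding vanishing_order_eq_d by blast
  have nz: "Q \<noteq> 0" using Q by auto
  have "0 = (\<Sum>j\<le>d. c j * poly (pCons 0 Q) (y j))"
    using root by simp
  also have "\<dots> = (\<Sum>k\<le>d + 2. coeff (pCons 0 Q) k * fact k * (fps_X ^ d * K) $ k)"
    unfolding exp_sum_moments[OF finite_atMost] K(1) using Q nz by (simp add: degree_pCons_eq)
  also have "\<dots> = (\<Sum>k\<in>{d, d+1, d+2}. coeff (pCons 0 Q) k * fact k * (fps_X ^ d * K) $ k)"
    by (rule sum.mono_neutral_right) (auto simp: fps_X_power_mult_nth)
  also have "\<dots> = coeff Q (d - 1) * fact d * K $ 0 + fact (d + 2) * K $ 2"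
    using Q K d by (simp add: fps_X_power_mult_nth coeff_pCons' numeral_eq_Suc)
  also have "fact (d + 2) = (real d + 2) * (real d + 1) * fact d"
    by (simp add: algebra_simps)
  finally have "K $ 0 * fact d * ((real d + 2) * (real d + 1) * (\<Sum>i=1..M. real (n i) * (real i)\<^sup>2 / 24))
      = K $ 0 * fact d * (\<Sum>k<Suc m. (z k)\<^sup>2)"
    unfolding K(4) Q(4) by (simp add: algebra_simps)
  then have *: "(real d + 2) * (real d + 1) * (\<Sum>i=1..M. real (n i) * (real i)\<^sup>2 / 24) = (\<Sum>k<Suc m. (z k)\<^sup>2)"
    using K(2) by simp
  have e: "(2 * real m + 3) * (2 * real m + 2) * (\<Sum>i=1..M. real (n i) * (real i)\<^sup>2)
      = 24 * (\<Sum>k<Suc m. (z k)\<^sup>2)"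
  proof -
    have "u * v * (S / 24) = Z \<Longrightarrow> u * v * S = 24 * Z" for u v S Z :: real by auto
    note this[OF *[unfolded sum_divide_distrib[symmetric]]]
    moreover have "real d + 2 = 2 * real m + 3" "real d + 1 = 2 * real m + 2" by (simp_all add: m)
    ultimately show ?thesis by (simp only:)
  qed
  have sq: "12 * (\<Sum>k<Suc j. (real k * u - v)\<^sup>2)
     = (real j + 1) * (2 * u\<^sup>2 * real j * (2 * real j + 1) - 12 * u * v * real j + 12 * v\<^sup>2)" for u v :: real and j
    by (induction j) (auto simp: algebra_simps power2_eq_square)
  have "12 * (\<Sum>k<Suc m. (z k)\<^sup>2) = (real m + 1) * ((real N)\<^sup>2 * real m * (real m + 2) + 3)"
    unfolding z_def sq W by (simp add: power2_eq_square field_simps)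
  with e have "(2 * (real m + 1)) * ((2 * real m + 3) * (\<Sum>i=1..M. real (n i) * (real i)\<^sup>2))
     = (2 * (real m + 1)) * ((real N)\<^sup>2 * real m * (real m + 2) + 3)"
    by (simp add: algebra_simps)
  then show ?thesis by (subst (asm) mult_cancel_left) auto
qed

text \<open>
  Expanding the square leaves the three sums of \<open>n i * i^k\<close> for \<open>k \<le> 2\<close>, all of which are known.
\<close>

lemma exponents_concentrated: "(\<Sum>i=1..M. real (n i) * (2 * real i - real N)\<^sup>2) < 2 * real N * (real N - 2)"
proof -
  obtain m where m: "d = 2 * m + 1" using odd_d oddE by blast
  have W: "W = m * N + 1" using W_eq_top_degree m by (simp add: \<nu>_odd)
  define T where "T = (\<Sum>i=1..M. real (n i) * (real i)\<^sup>2)"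
  define S where "S = (\<Sum>i=1..M. real (n i) * (2 * real i - real N)\<^sup>2)"
  have S: "S = 4 * T - 4 * real N * real W + (real N)\<^sup>2 * real d"
    unfolding S_def T_def W_def vanishing_order_eq_d[symmetric]
    by (simp add: sum_distrib_left sum_subtractf[symmetric] sum.distrib[symmetric] power2_eq_square algebra_simps)
  have "(2 * real m + 3) * S
    = 4 * ((2 * real m + 3) * T) - (2 * real m + 3) * (4 * real N * real W - (real N)\<^sup>2 * real d)"
    unfolding S by (simp add: algebra_simps)
  also have "\<dots> = (2 * real m + 3) * (2 * real N * (real N - 2)) - 3 * (real N - 2) * (real N + 2)"
    unfolding T_def second_moment[OF m] W m by (simp add: algebra_simps power2_eq_square)
  also have "\<dots> < (2 * real m + 3) * (2 * real N * (real N - 2))"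
    using N by simp
  finally show ?thesis unfolding S_def by (subst (asm) mult_less_cancel_left_pos) auto
qed

text \<open>
  The polynomial has no exponents strictly between \<open>1\<close> and \<open>N\<close>.
\<close>

lemma divisor_sums:
  assumes "1 \<le> k" "k < N"
  shows "(\<Sum>i | i \<in> {1..M} \<and> i dvd k. n i * i) = b 1 ^ k"
proof -
  have f: "fps_of_poly p = (\<Prod>i=1..M. (1 - fps_X ^ i) ^ n i)"
    by (simp add: p_eq_product fps_of_poly_prod fps_of_poly_power fps_of_poly_diff fps_of_poly_monom)
  have 1: "fps_of_poly p $ 1 = - real (b 1)"
    using coeff_p[of 1] d by (simp add: \<nu>_small c_def)
  have "fps_of_poly p $ j = 0" if "2 \<le> j" "j < N" for j
  proof -
    have "j \<noteq> \<nu> i" for i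
    proof
      assume j: "j = \<nu> i"
      then have "1 < i" using that(1) \<nu>_less_iff[of 1 i] \<nu>_small by simp
      moreover have "i < 2" using j that(2) \<nu>_less_iff[of i 2] \<nu>_small by simp
      ultimately show False by simp
    qed
    then show ?thesis by (auto intro: coeff_p_gap)
  qed
  from divisor_power_sums[OF f 1 this assms]
  have "real (\<Sum>i | i \<in> {1..M} \<and> i dvd k. n i * i) = real (b 1 ^ k)" by simp
  then show ?thesis by (simp only: of_nat_eq_iff)
qed

lemma n_1_eq_b_1: "n 1 = b 1"
proof -
  have "{i. i \<in> {1..M} \<and> i dvd 1} = {1::nat}" using N NM by auto
  then show ?thesis using divisor_sums[of 1] N by simp
qed

lemma N_d_eq_3: "N = 3 \<and> d = 3"
proof -
  have mem: "1 \<in> {1..M}" "N - 1 \<in> {1..M}" "1 \<noteq> N - 1" using N NM by auto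
  have "(\<Sum>i\<in>{1, N - 1}. real (n i) * (2 * real i - real N)\<^sup>2)
     \<le> (\<Sum>i=1..M. real (n i) * (2 * real i - real N)\<^sup>2)"
    using mem by (intro sum_mono2) auto
  also note exponents_concentrated
  finally have "(real (n 1) + real (n (N - 1))) * (real N - 2)\<^sup>2 < 2 * real N * (real N - 2)"
    using mem N by (simp add: of_nat_diff algebra_simps power2_eq_square)
  then have "(real N - 2) * ((real (n 1) + real (n (N - 1))) * (real N - 2)) < (real N - 2) * (2 * real N)"
    by (simp add: algebra_simps power2_eq_square)
  then have lt: "(real (n 1) + real (n (N - 1))) * (real N - 2) < 2 * real N"
    using N by (subst (asm) mult_less_cancel_left_pos) auto
  have N3: "N = 3"
  proof (rule ccontr)
    assume "N \<noteq> 3"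
    then have N4: "N \<ge> 4" using N by simp
    have "n (N - 1) \<ge> 2"
      by (rule exponent_lower_bound[OF divisor_sums b_1_ge NM N4])
    then have "4 * (real N - 2) \<le> (real (n 1) + real (n (N - 1))) * (real N - 2)"
      using n_1_eq_b_1 b_1_ge N by (intro mult_right_mono) auto
    then show False using lt N4 by simp
  qed
  have "{i. i \<in> {1..M} \<and> i dvd 2} = {1, 2::nat}"
    using N NM by (auto dest: dvd_imp_le)
  then have 2: "n 1 + n 2 * 2 = n 1 ^ 2" using divisor_sums[of 2] N3 n_1_eq_b_1 by simp
  have "n 1 + n 2 < 6" using lt N3 by simp
  then have "n 1 < 3"
  proof -
    assume *: "n 1 + n 2 < 6"
    show "n 1 < 3"
    proof (rule ccontr)
      assume "\<not> n 1 < 3"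
      then have "3 * n 1 \<le> n 1 ^ 2" by (simp add: power2_eq_square)
      then show False using 2 * \<open>\<not> n 1 < 3\<close> by linarith
    qed
  qed
  then have "b 1 = 2" using n_1_eq_b_1 b_1_ge by simp
  then show ?thesis using N3 d_eq_3_of_b_1_eq_2 odd_d by simp
qed

end

section \<open>Homogeneous components\<close>

lemma sum_fun_eval: "(\<Sum>i\<in>A. f i) k = (\<Sum>i\<in>A. f i k)" for f :: "'i \<Rightarrow> 'b \<Rightarrow> 'c::comm_monoid_add"
  by (induction A rule: infinite_finite_induct) (simp_all add: zero_fun_def plus_fun_def)

lemma add_subgroup_closed:
  assumes "add_subgroup S"
  shows "0 \<in> S" "x \<in> S \<Longrightarrow> y \<in> S \<Longrightarrow> x - y \<in> S" "x \<in> S \<Longrightarrow> - x \<in> S" "x \<in> S \<Longrightarrow> y \<in> S \<Longrightarrow> x + y \<in> S"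
proof -
  show 0: "0 \<in> S" and d: "x \<in> S \<Longrightarrow> y \<in> S \<Longrightarrow> x - y \<in> S" for x y
    using assms by (auto simp: add_subgroup_def)
  show m: "x \<in> S \<Longrightarrow> - x \<in> S" for x using d[OF 0] by fastforce
  show "x \<in> S \<Longrightarrow> y \<in> S \<Longrightarrow> x + y \<in> S" using d[OF _ m] by fastforce
qed

lemma add_subgroup_sum:
  "add_subgroup S \<Longrightarrow> (\<And>i. i \<in> A \<Longrightarrow> f i \<in> S) \<Longrightarrow> (\<Sum>i\<in>A. f i) \<in> S"
  by (induction A rule: infinite_finite_induct) (auto simp: add_subgroup_closed)

lemma direct_sum_subgroup:
  assumes "direct_sum_of S C"
  shows "add_subgroup S" "add_subgroup (C i)" "C i \<subseteq> S" "x \<in> C i \<Longrightarrow> x \<in> S"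
  using assms by (auto simp: direct_sum_of_def)

text \<open>
  Outside the direct sum the value is unspecified.
\<close>

definition component :: "('i \<Rightarrow> 'm::ab_group_add set) \<Rightarrow> 'm \<Rightarrow> 'i \<Rightarrow> 'm" where
  "component C x = (THE f. (\<forall>i. f i \<in> C i) \<and> finite {i. f i \<noteq> 0} \<and> x = (\<Sum>i | f i \<noteq> 0. f i))"

lemma component:
  assumes "direct_sum_of S C" "x \<in> S"
  shows component_in: "component C x i \<in> C i"
    and component_finite: "finite {i. component C x i \<noteq> 0}"
    and component_sum: "(\<Sum>i | component C x i \<noteq> 0. component C x i) = x"
proof -
  have "\<exists>!f. (\<forall>i. f i \<in> C i) \<and> finite {i. f i \<noteq> 0} \<and> x = (\<Sum>i | f i \<noteq> 0. f i)"
    using assms by (auto simp: direct_sum_of_def)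
  from theI'[OF this] show "component C x i \<in> C i" "finite {i. component C x i \<noteq> 0}"
    "(\<Sum>i | component C x i \<noteq> 0. component C x i) = x"
    by (auto simp: component_def)
qed

lemma component_sum_superset:
  assumes "direct_sum_of S C" "x \<in> S" "finite A" "{i. component C x i \<noteq> 0} \<subseteq> A"
  shows "(\<Sum>i\<in>A. component C x i) = x"
proof -
  have "(\<Sum>i\<in>A. component C x i) = (\<Sum>i | component C x i \<noteq> 0. component C x i)"
    using assms(3,4) by (rule sum.mono_neutral_right) blast
  also note component_sum[OF assms(1,2)]
  finally show ?thesis .
qed

lemma component_eqI:
  assumes "direct_sum_of S C" "finite A" "\<And>i. f i \<in> C i" "\<And>i. i \<notin> A \<Longrightarrow> f i = 0" "x = (\<Sum>i\<in>A. f i)"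
  shows "component C x = f"
proof -
  have sub: "{i. f i \<noteq> 0} \<subseteq> A" using assms(4) by auto
  have "x \<in> S"
    unfolding assms(5) using assms(1,3) by (intro add_subgroup_sum) (auto intro: direct_sum_subgroup)
  then have "\<exists>!f. (\<forall>i. f i \<in> C i) \<and> finite {i. f i \<noteq> 0} \<and> x = (\<Sum>i | f i \<noteq> 0. f i)"
    using assms(1) by (auto simp: direct_sum_of_def)
  moreover have "(\<forall>i. f i \<in> C i) \<and> finite {i. f i \<noteq> 0} \<and> x = (\<Sum>i | f i \<noteq> 0. f i)"
  proof (intro conjI allI assms(3))
    show "finite {i. f i \<noteq> 0}" using sub assms(2) by (rule finite_subset)
    show "x = (\<Sum>i | f i \<noteq> 0. f i)"
      unfolding assms(5) using sub assms(2) by (intro sum.mono_neutral_right) auto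
  qed
  ultimately show ?thesis
    unfolding component_def
    by (rule the1_equality[where P = "\<lambda>f. (\<forall>i. f i \<in> C i) \<and> finite {i. f i \<noteq> 0} \<and> x = (\<Sum>i | f i \<noteq> 0. f i)"])
qed

lemma component_homogeneous:
  assumes "direct_sum_of S C" "x \<in> C j"
  shows "component C x = (\<lambda>i. if i = j then x else 0)"
proof (rule component_eqI[OF assms(1), of "{j}"])
  show "(if i = j then x else 0) \<in> C i" for i
    using assms(2) add_subgroup_closed(1)[OF direct_sum_subgroup(2)[OF assms(1)]] by simp
qed simp_all

lemma component_diff:
  assumes "direct_sum_of S C" "x \<in> S" "y \<in> S"
  shows "component C (x - y) i = component C x i - component C y i"
proof -
  let ?A = "{i. component C x i \<noteq> 0} \<union> {i. component C y i \<noteq> 0}"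
  have fin: "finite ?A" using component_finite[OF assms(1)] assms(2,3) by simp
  have "(\<Sum>i\<in>?A. component C x i) = x" "(\<Sum>i\<in>?A. component C y i) = y"
    by (rule component_sum_superset[OF assms(1,2) fin] component_sum_superset[OF assms(1,3) fin]; blast)+
  then have "x - y = (\<Sum>i\<in>?A. component C x i - component C y i)"
    by (simp add: sum_subtractf)
  moreover have "component C x i - component C y i \<in> C i" for i
    by (intro add_subgroup_closed(2) direct_sum_subgroup(2)[OF assms(1)] component_in[OF assms(1)] assms)
  ultimately show ?thesis
    using component_eqI[OF assms(1) fin, of "\<lambda>i. component C x i - component C y i" "x - y"] by simp
qed

lemma component_add:
  assumes "direct_sum_of S C" "x \<in> S" "y \<in> S"
  shows "component C (x + y) i = component C x i + component C y i"
proof -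
  have "x + y \<in> S" using assms direct_sum_subgroup(1)[OF assms(1)] by (simp add: add_subgroup_closed)
  from component_diff[OF assms(1) this assms(3), of i] show ?thesis by simp
qed

lemma additive_zero:
  fixes f :: "'m::ab_group_add \<Rightarrow> 'n::ab_group_add"
  assumes S: "add_subgroup S" and add: "\<And>x y. x \<in> S \<Longrightarrow> y \<in> S \<Longrightarrow> f (x + y) = f x + f y"
  shows "f 0 = 0"
  using add[of 0 0] add_subgroup_closed(1)[OF S] by simp

lemma additive_sum:
  fixes f :: "'m::ab_group_add \<Rightarrow> 'n::ab_group_add"
  assumes S: "add_subgroup S" and add: "\<And>x y. x \<in> S \<Longrightarrow> y \<in> S \<Longrightarrow> f (x + y) = f x + f y"
    and A: "\<And>i. i \<in> A \<Longrightarrow> g i \<in> S"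
  shows "f (\<Sum>i\<in>A. g i) = (\<Sum>i\<in>A. f (g i))"
proof -
  have z: "f 0 = 0" by (rule additive_zero[OF S add])
  show ?thesis
    using A
  proof (induction A rule: infinite_finite_induct)
    case (insert x F)
    then show ?case by (simp add: add S add_subgroup_sum)
  qed (simp_all add: z)
qed

text \<open>
  Taking components commutes with degree-preserving additive maps.  This is how exactness and
  bijectivity statements pass to single degrees.
\<close>

lemma component_map:
  fixes f :: "'m::ab_group_add \<Rightarrow> 'n::ab_group_add"
  assumes "direct_sum_of S C" "direct_sum_of T D" "x \<in> S"
    and add: "\<And>x y. x \<in> S \<Longrightarrow> y \<in> S \<Longrightarrow> f (x + y) = f x + f y"
    and hom: "\<And>i. f ` C i \<subseteq> D i"
  shows "component D (f x) i = f (component C x i)"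
proof -
  let ?A = "{i. component C x i \<noteq> 0}"
  have S: "add_subgroup S" using assms(1) by (rule direct_sum_subgroup)
  have inS: "component C x i \<in> S" for i
    using component_in[OF assms(1,3)] assms(1) by (auto intro: direct_sum_subgroup)
  have z: "f 0 = 0" by (rule additive_zero[OF S add])
  have "f x = f (\<Sum>i\<in>?A. component C x i)"
    using component_sum[OF assms(1,3)] by simp
  also have "\<dots> = (\<Sum>i\<in>?A. f (component C x i))"
    using S add inS by (intro additive_sum) auto
  finally have "component D (f x) = (\<lambda>i. f (component C x i))"
    using component_in[OF assms(1,3)] hom z component_finite[OF assms(1,3)]
    by (intro component_eqI[OF assms(2), of ?A]) auto
  then show ?thesis by simp
qed

lemma direct_sum_induct:
  assumes "direct_sum_of S C" "x \<in> S"
    and "P 0" "\<And>x y. P x \<Longrightarrow> P y \<Longrightarrow> P (x + y)" "\<And>i x. x \<in> C i \<Longrightarrow> P x"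
  shows "P x"
proof -
  have "P (\<Sum>i\<in>A. component C x i)" for A
    by (induction A rule: infinite_finite_induct) (auto intro: assms component_in[OF assms(1,2)])
  from this[of "{i. component C x i \<noteq> 0}"] show ?thesis
    using component_sum[OF assms(1,2)] by simp
qed

text \<open>
  Uniqueness of decompositions is automatic once the components are given by additive projections.
\<close>

lemma direct_sum_ofI:
  assumes "add_subgroup S" "\<And>i. add_subgroup (C i)" "\<And>i. C i \<subseteq> S"
    and pr: "\<And>x i. x \<in> S \<Longrightarrow> pr x i \<in> C i"
    and add: "\<And>x y i. x \<in> S \<Longrightarrow> y \<in> S \<Longrightarrow> pr (x + y) i = pr x i + pr y i"
    and hom: "\<And>i j x. x \<in> C i \<Longrightarrow> pr x j = (if j = i then x else 0)"
    and sum: "\<And>x. x \<in> S \<Longrightarrow> \<exists>A. finite A \<and> (\<forall>i. i \<notin> A \<longrightarrow> pr x i = 0) \<and> x = (\<Sum>i\<in>A. pr x i)"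
  shows "direct_sum_of S C"
  unfolding direct_sum_of_def
proof (intro conjI allI ballI assms(1,2,3))
  fix x assume x: "x \<in> S"
  show "\<exists>!f. (\<forall>i. f i \<in> C i) \<and> finite {i. f i \<noteq> 0} \<and> x = (\<Sum>i | f i \<noteq> 0. f i)"
  proof (rule ex1I[of _ "pr x"])
    from sum[OF x] obtain A where A: "finite A" "\<forall>i. i \<notin> A \<longrightarrow> pr x i = 0" "x = (\<Sum>i\<in>A. pr x i)" by blast
    have "{i. pr x i \<noteq> 0} \<subseteq> A" using A(2) by auto
    moreover from this have "(\<Sum>i\<in>A. pr x i) = (\<Sum>i | pr x i \<noteq> 0. pr x i)"
      using A by (intro sum.mono_neutral_right) auto
    ultimately show "(\<forall>i. pr x i \<in> C i) \<and> finite {i. pr x i \<noteq> 0} \<and> x = (\<Sum>i | pr x i \<noteq> 0. pr x i)"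
      using A pr[OF x] finite_subset by auto
  next
    fix f assume f: "(\<forall>i. f i \<in> C i) \<and> finite {i. f i \<noteq> 0} \<and> x = (\<Sum>i | f i \<noteq> 0. f i)"
    show "f = pr x"
    proof
      fix j
      have "pr (\<Sum>i | f i \<noteq> 0. f i) j = (\<Sum>i | f i \<noteq> 0. pr (f i) j)"
        using assms(3) f by (intro additive_sum[OF assms(1) add]) blast+
      also have "\<dots> = (\<Sum>i | f i \<noteq> 0. if j = i then f i else 0)"
        using hom f by (intro sum.cong) auto
      also have "\<dots> = f j" using f by (subst sum.delta') auto
      finally show "f j = pr x j" using f by simp
    qed
  qed
qed

section \<open>Rank and nullity on a finite-dimensional subspace\<close>

text \<open>
  A basis of the kernel is extended to a basis of \<open>S\<close>, and the added vectors map to a basis of the image.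
\<close>

lemma (in vector_space_pair) rank_nullity:
  assumes lin: "Vector_Spaces.linear s1 s2 f" and S: "vs1.subspace S" and fin: "finite B" "S \<subseteq> vs1.span B"
  shows "vs1.dim S = vs1.dim {x \<in> S. f x = 0} + vs2.dim (f ` S)"
proof -
  interpret f: Vector_Spaces.linear s1 s2 f by fact
  let ?Z = "{x \<in> S. f x = 0}"
  obtain K where K: "K \<subseteq> ?Z" "vs1.independent K" "?Z \<subseteq> vs1.span K"
    by (rule vs1.maximal_independent_subset)
  have "K \<subseteq> S" using K(1) by blast
  then obtain C where C: "K \<subseteq> C" "C \<subseteq> S" "vs1.independent C" "S \<subseteq> vs1.span C"
    using vs1.maximal_independent_subset_extend[OF _ K(2)] by metis
  have finC: "finite C" using vs1.independent_span_bound[OF fin(1) C(3)] C(2) fin(2) by blast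
  define D where "D = C - K"
  have fins: "finite K" "finite D" using finC C(1) finite_subset by (auto simp: D_def)
  have Ceq: "C = K \<union> D" "K \<inter> D = {}" using C(1) by (auto simp: D_def)
  have zero: "x = 0" if x: "x \<in> vs1.span D" "f x = 0" for x
  proof -
    have "x \<in> S" using x(1) vs1.span_minimal[OF _ S, of D] C(2) D_def by blast
    then have "x \<in> vs1.span K" using K(3) x(2) by blast
    then obtain u where u: "x = (\<Sum>v\<in>K. s1 (u v) v)" using vs1.span_finite[OF fins(1)] by auto
    obtain w where w: "x = (\<Sum>v\<in>D. s1 (w v) v)" using x(1) vs1.span_finite[OF fins(2)] by auto
    have "(\<Sum>v\<in>C. s1 (if v \<in> K then u v else - w v) v) = (\<Sum>v\<in>K. s1 (u v) v) + (\<Sum>v\<in>D. s1 (- w v) v)"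
      unfolding Ceq(1) using fins Ceq(2)
      by (subst sum.union_disjoint) (auto intro!: arg_cong2[of _ _ _ _ "(+)"] sum.cong)
    also have "\<dots> = 0" using u w by (simp add: vs1.scale_minus_left sum_negf)
    finally have "(if v \<in> K then u v else - w v) = 0" if "v \<in> C" for v
      using vs1.independentD[OF C(3) finC subset_refl, of "\<lambda>v. if v \<in> K then u v else - w v" v] that by simp
    then have "u v = 0" if "v \<in> K" for v using that C(1) by (metis subsetD)
    then show ?thesis by (simp add: u)
  qed
  have inj: "inj_on f (vs1.span D)"
  proof (rule inj_onI)
    fix x y assume xy: "x \<in> vs1.span D" "y \<in> vs1.span D" "f x = f y"
    then have "x - y = 0" by (intro zero) (auto simp: vs1.span_diff f.diff)
    then show "x = y" by simp
  qed
  have "vs1.independent D" using C(3) by (rule vs1.independent_mono) (simp add: D_def)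
  then have ind: "vs2.independent (f ` D)" using inj by (rule f.independent_inj_on_image)
  have "f ` S \<subseteq> f ` vs1.span C" using C(4) by blast
  also have "\<dots> = vs2.span (f ` C)" by (rule f.span_image[symmetric])
  also have "\<dots> \<subseteq> vs2.span (f ` D)"
  proof (rule vs2.span_minimal)
    show "f ` C \<subseteq> vs2.span (f ` D)"
    proof (intro image_subsetI)
      fix v assume "v \<in> C"
      then consider "f v = 0" | "v \<in> D" using K(1) Ceq(1) by blast
      then show "f v \<in> vs2.span (f ` D)" by cases (auto simp: vs2.span_zero vs2.span_base)
    qed
  qed simp
  finally have sp: "f ` S \<subseteq> vs2.span (f ` D)" .
  have "inj_on f D" using inj vs1.span_superset by (rule inj_on_subset)
  then have "card (f ` D) = card D" by (rule card_image)
  moreover have "f ` D \<subseteq> f ` S" using C(2) by (auto simp: D_def)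
  ultimately have "vs2.dim (f ` S) = card D" using sp ind by (intro vs2.dim_unique) auto
  moreover have "vs1.dim ?Z = card K" using K by (intro vs1.dim_unique) auto
  moreover have "vs1.dim S = card C" using C by (intro vs1.dim_unique) auto
  moreover have "card C = card K + card D"
    unfolding Ceq(1) by (rule card_Un_disjoint[OF fins Ceq(2)])
  ultimately show ?thesis by simp
qed

section \<open>Free graded modules\<close>

context graded_algebra
begin

text \<open>
  The grading extended by zero to negative degrees, so that shifts of degree need no side condition.
\<close>

definition homog :: "int \<Rightarrow> 'a set" where "homog i = (if i \<ge> 0 then gr (nat i) else {0})"

lemma homog_int [simp]: "homog (int n) = gr n"
  by (simp add: homog_def)

lemma zero_in_gr [simp]: "0 \<in> gr n"
  using gr_subspace subspace_0 by blast

lemma homog_subspace: "subspace (homog i)"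
  by (simp add: homog_def gr_subspace subspace_single_0)

lemma add_subgroup_subspace: "subspace S \<Longrightarrow> add_subgroup S"
  by (simp add: add_subgroup_def subspace_0 subspace_diff)

lemma homog_mult: "a \<in> gr i \<Longrightarrow> x \<in> homog j \<Longrightarrow> a * x \<in> homog (int i + j)"
proof (cases j rule: int_cases2)
  case (nonneg n)
  then show "a \<in> gr i \<Longrightarrow> x \<in> homog j \<Longrightarrow> a * x \<in> homog (int i + j)"
    using gr_mult[of a i x n] by (simp flip: of_nat_add)
next
  case (nonpos n)
  show "a \<in> gr i \<Longrightarrow> x \<in> homog j \<Longrightarrow> a * x \<in> homog (int i + j)"
    using gr_mult[of a i x "nat j"] subspace_0[OF homog_subspace] nonpos by (cases "n = 0") (auto simp: homog_def)
qed

lemma scale_one_mult [simp]: "scale c 1 * x = scale c x"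
  by (simp add: scale_mult_left)

lemma homog_direct_sum: "direct_sum_of UNIV homog"
proof (rule direct_sum_ofI[where pr = "\<lambda>x i. if i \<ge> 0 then component gr x (nat i) else 0"])
  note gr = gr_direct_sum
  show "(if 0 \<le> i then component gr x (nat i) else 0) \<in> homog i" for x i
    using component_in[OF gr, of x "nat i"] by (simp add: homog_def)
  show "(if 0 \<le> i then component gr (x + y) (nat i) else 0)
      = (if 0 \<le> i then component gr x (nat i) else 0) + (if 0 \<le> i then component gr y (nat i) else 0)" for x y i
    using component_add[OF gr, of x y "nat i"] by simp
  show "(if 0 \<le> j then component gr x (nat j) else 0) = (if j = i then x else 0)" if "x \<in> homog i" for i j x
  proof (cases "i \<ge> 0")
    case True
    then have "x \<in> gr (nat i)" using that by (simp add: homog_def)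
    from component_homogeneous[OF gr this] True show ?thesis by auto
  next
    case False
    then have x: "x = 0" using that by (simp add: homog_def)
    show ?thesis using component_homogeneous[OF gr zero_in_gr] x by auto
  qed
  show "\<exists>A. finite A \<and> (\<forall>i. i \<notin> A \<longrightarrow> (if 0 \<le> i then component gr x (nat i) else 0) = 0)
      \<and> x = (\<Sum>i\<in>A. if 0 \<le> i then component gr x (nat i) else 0)" for x
  proof (intro exI conjI allI impI)
    let ?A = "int ` {n. component gr x n \<noteq> 0}"
    show "finite ?A" using component_finite[OF gr, of x] by simp
    show "(if 0 \<le> i then component gr x (nat i) else 0) = 0" if "i \<notin> ?A" for i
      using that by (metis (mono_tags, lifting) image_eqI int_nat_eq mem_Collect_eq)
    show "x = (\<Sum>i\<in>?A. if 0 \<le> i then component gr x (nat i) else 0)"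
      using component_sum[OF gr, of x] by (simp add: sum.reindex)
  qed
qed (auto simp: add_subgroup_def intro: add_subgroup_subspace[unfolded add_subgroup_def] homog_subspace
      subspace_0[OF homog_subspace] subspace_diff[OF homog_subspace])

text \<open>
  Columns \<open>nat \<Rightarrow> 'a\<close> form a genuine vector space on a whole type, unlike the carriers of graded
  modules.  All dimension counts are therefore made in coordinates with respect to free bases.
\<close>

definition fscale :: "'k \<Rightarrow> (nat \<Rightarrow> 'a) \<Rightarrow> (nat \<Rightarrow> 'a)" where
  "fscale c f = (\<lambda>k. scale c (f k))"

lemma vector_space_fscale: "vector_space fscale"
  by unfold_locales (auto simp: fscale_def plus_fun_def scale_left_distrib scale_right_distrib)

interpretation fv: vector_space fscale by (rule vector_space_fscale)
interpretation fs: vector_space_pair fscale scale ..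
interpretation ff: vector_space_pair fscale fscale ..

text \<open>
  The degree \<open>j\<close> part of the free module on \<open>b\<close> generators of degree zero; in \<open>free_module b \<nu>\<close> the
  generators have degree \<open>\<nu>\<close>.
\<close>

definition coords :: "nat \<Rightarrow> int \<Rightarrow> (nat \<Rightarrow> 'a) set" where
  "coords b j = {f. (\<forall>k. f k \<in> homog j) \<and> (\<forall>k\<ge>b. f k = 0)}"

definition free_module :: "nat \<Rightarrow> int \<Rightarrow> 'a umod" where
  "free_module b \<nu> = \<lparr>carrier = {f. \<forall>k\<ge>b. f k = 0}, act = (\<lambda>a f k. a * f k), hcomp = (\<lambda>j. coords b (j - \<nu>))\<rparr>"

lemma free_module_simps [simp]:
  "carrier (free_module b \<nu>) = {f. \<forall>k\<ge>b. f k = 0}"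
  "act (free_module b \<nu>) a f = (\<lambda>k. a * f k)"
  "hcomp (free_module b \<nu>) j = coords b (j - \<nu>)"
  by (simp_all add: free_module_def)

lemma coords_subspace: "fv.subspace (coords b j)"
  using homog_subspace[of j]
  by (auto simp: fv.subspace_def coords_def fscale_def plus_fun_def zero_fun_def subspace_0 subspace_add subspace_scale)

lemma free_module_direct_sum:
  "direct_sum_of (carrier (free_module b \<nu>)) (hcomp (free_module b \<nu>))"
proof (rule direct_sum_ofI[where pr = "\<lambda>f i k. component homog (f k) (i - \<nu>)"])
  note hd = homog_direct_sum
  have comp0: "component homog 0 i = 0" for i
    using component_homogeneous[OF hd subspace_0[OF homog_subspace]] by simp
  show "add_subgroup (carrier (free_module b \<nu>))"
    by (simp add: add_subgroup_def)
  show "add_subgroup (hcomp (free_module b \<nu>) i)" for i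
    using coords_subspace by (simp add: add_subgroup_def fv.subspace_0 fv.subspace_diff)
  show "hcomp (free_module b \<nu>) i \<subseteq> carrier (free_module b \<nu>)" for i
    by (auto simp: coords_def)
  show "(\<lambda>k. component homog (x k) (i - \<nu>)) \<in> hcomp (free_module b \<nu>) i"
    if "x \<in> carrier (free_module b \<nu>)" for x i
    using that component_in[OF hd] by (simp add: coords_def comp0)
  show "(\<lambda>k. component homog ((x + y) k) (i - \<nu>))
      = (\<lambda>k. component homog (x k) (i - \<nu>)) + (\<lambda>k. component homog (y k) (i - \<nu>))" for x y i
    using component_add[OF hd] by (simp add: plus_fun_def)
  show "(\<lambda>k. component homog (x k) (j - \<nu>)) = (if j = i then x else 0)"
    if "x \<in> hcomp (free_module b \<nu>) i" for i j x
  proof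
    fix k
    have "x k \<in> homog (i - \<nu>)" using that by (simp add: coords_def)
    from component_homogeneous[OF hd this]
    show "component homog (x k) (j - \<nu>) = (if j = i then x else 0) k" by simp
  qed
  show "\<exists>A. finite A \<and> (\<forall>i. i \<notin> A \<longrightarrow> (\<lambda>k. component homog (x k) (i - \<nu>)) = 0)
      \<and> x = (\<Sum>i\<in>A. (\<lambda>k. component homog (x k) (i - \<nu>)))"
    if x: "x \<in> carrier (free_module b \<nu>)" for x
  proof (intro exI conjI allI impI)
    let ?B = "\<Union>k<b. {i. component homog (x k) i \<noteq> 0}"
    let ?A = "(\<lambda>i. i + \<nu>) ` ?B"
    have finB: "finite ?B" using component_finite[OF hd] by simp
    then show "finite ?A" by simp
    have sup: "{i. component homog (x k) i \<noteq> 0} \<subseteq> ?B" for k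
    proof (cases "k < b")
      case False
      then show ?thesis using x comp0 by auto
    qed auto
    show "(\<lambda>k. component homog (x k) (i - \<nu>)) = 0" if "i \<notin> ?A" for i
    proof
      fix k
      show "component homog (x k) (i - \<nu>) = 0 k"
      proof (rule ccontr)
        assume "component homog (x k) (i - \<nu>) \<noteq> 0 k"
        then have "i - \<nu> \<in> ?B" using sup[of k] by auto
        then have "i - \<nu> + \<nu> \<in> ?A" by (rule imageI)
        then show False using that by simp
      qed
    qed
    show "x = (\<Sum>i\<in>?A. (\<lambda>k. component homog (x k) (i - \<nu>)))"
    proof
      fix k
      have "(\<Sum>i\<in>?A. (\<lambda>k. component homog (x k) (i - \<nu>))) k = (\<Sum>i\<in>?B. component homog (x k) i)"
        by (simp add: sum_fun_eval sum.reindex)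
      also have "\<dots> = x k"
        using finB sup by (intro component_sum_superset[OF hd]) auto
      finally show "x k = (\<Sum>i\<in>?A. (\<lambda>k. component homog (x k) (i - \<nu>))) k" ..
    qed
  qed
qed

lemma graded_moduleD:
  assumes "graded_module M"
  shows "direct_sum_of (carrier M) (hcomp M)"
    and "x \<in> carrier M \<Longrightarrow> act M a x \<in> carrier M"
    and "x \<in> carrier M \<Longrightarrow> act M 1 x = x"
    and "x \<in> carrier M \<Longrightarrow> act M (a * a') x = act M a (act M a' x)"
    and "x \<in> carrier M \<Longrightarrow> act M (a + a') x = act M a x + act M a' x"
    and "x \<in> carrier M \<Longrightarrow> y \<in> carrier M \<Longrightarrow> act M a (x + y) = act M a x + act M a y"
    and "a \<in> gr i \<Longrightarrow> x \<in> hcomp M j \<Longrightarrow> act M a x \<in> hcomp M (int i + j)"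
  using assms by (auto simp: graded_module_def)

lemma graded_module_carrier:
  assumes "graded_module M"
  shows "add_subgroup (carrier M)" "x \<in> hcomp M j \<Longrightarrow> x \<in> carrier M" "add_subgroup (hcomp M j)"
  using direct_sum_subgroup[OF graded_moduleD(1)[OF assms]] by auto

lemma act_zero:
  assumes "graded_module M"
  shows "x \<in> carrier M \<Longrightarrow> act M 0 x = 0" "act M a 0 = 0"
proof -
  show "x \<in> carrier M \<Longrightarrow> act M 0 x = 0"
    using graded_moduleD(5)[OF assms, of x 0 0] by simp
  show "act M a 0 = 0"
    using graded_moduleD(6)[OF assms, of 0 0 a] add_subgroup_closed(1)[OF graded_module_carrier(1)[OF assms]] by simp
qed

lemma act_sum:
  assumes "graded_module M" "\<And>i. i \<in> A \<Longrightarrow> f i \<in> carrier M"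
  shows "act M a (\<Sum>i\<in>A. f i) = (\<Sum>i\<in>A. act M a (f i))"
  by (rule additive_sum[OF graded_module_carrier(1)[OF assms(1)] graded_moduleD(6)[OF assms(1)]])
    (use assms(2) in auto)

lemma free_module_graded: "graded_module (free_module b \<nu>)"
  unfolding graded_module_def
proof (intro conjI allI ballI free_module_direct_sum)
  fix i j a x
  assume "a \<in> gr i" "x \<in> hcomp (free_module b \<nu>) j"
  then show "act (free_module b \<nu>) a x \<in> hcomp (free_module b \<nu>) (int i + j)"
    using homog_mult[of a i _ "j - \<nu>"] by (auto simp: coords_def algebra_simps)
qed (auto simp: algebra_simps plus_fun_def)

text \<open>
  The elements without components below degree \<open>\<nu>\<close> form a submodule, as the algebra lives in
  nonnegative degrees, and this submodule contains the degree \<open>\<nu>\<close> part.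
\<close>

lemma generated_in_degree_vanish:
  assumes M: "graded_module M" and gen: "generated_in_degree M \<nu>" and j: "j < \<nu>"
  shows "hcomp M j = {0}"
proof -
  note ds = graded_moduleD(1)[OF M]
  define S where "S = {x \<in> carrier M. \<forall>i<\<nu>. component (hcomp M) x i = 0}"
  have comp0: "component (hcomp M) 0 i = 0" for i
    using component_homogeneous[OF ds, of 0 i] add_subgroup_closed(1)[OF graded_module_carrier(3)[OF M]] by simp
  have subS: "add_subgroup S"
    unfolding add_subgroup_def S_def
    using component_diff[OF ds] add_subgroup_closed[OF graded_module_carrier(1)[OF M]]
    by (auto simp: comp0)
  have high: "hcomp M i \<subseteq> S" if "i \<ge> \<nu>" for i
    using that component_homogeneous[OF ds, of _ i] graded_module_carrier(2)[OF M] by (auto simp: S_def)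
  have act: "\<forall>x\<in>S. act M a x \<in> S" for a
  proof (rule direct_sum_induct[OF gr_direct_sum, of a])
    show "\<forall>x\<in>S. act M 0 x \<in> S"
      using act_zero(1)[OF M] add_subgroup_closed(1)[OF subS] by (auto simp: S_def)
    show "\<forall>x\<in>S. act M (a + b) x \<in> S" if "\<forall>x\<in>S. act M a x \<in> S" "\<forall>x\<in>S. act M b x \<in> S" for a b
      using that graded_moduleD(5)[OF M, of _ a b] add_subgroup_closed(4)[OF subS] by (auto simp: S_def)
    show "\<forall>x\<in>S. act M a x \<in> S" if a: "a \<in> gr k" for a k
    proof
      fix x assume x: "x \<in> S"
      then have xc: "x \<in> carrier M" by (simp add: S_def)
      let ?A = "{i. component (hcomp M) x i \<noteq> 0}"
      have "act M a x = act M a (\<Sum>i\<in>?A. component (hcomp M) x i)"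
        by (simp only: component_sum[OF ds xc])
      also have "\<dots> = (\<Sum>i\<in>?A. act M a (component (hcomp M) x i))"
        using component_in[OF ds xc] graded_module_carrier(2)[OF M] by (intro act_sum[OF M]) blast
      also have "\<dots> \<in> S"
      proof (rule add_subgroup_sum[OF subS])
        fix i assume "i \<in> ?A"
        then have "i \<ge> \<nu>" using x by (force simp: S_def)
        then show "act M a (component (hcomp M) x i) \<in> S"
          using graded_moduleD(7)[OF M a component_in[OF ds xc, of i]] high[of "int k + i"] by auto
      qed
      finally show "act M a x \<in> S" .
    qed
  qed simp
  have "S \<subseteq> carrier M" by (auto simp: S_def)
  then have S: "S = carrier M"
    using gen subS act high[of \<nu>] unfolding generated_in_degree_def by blast
  show ?thesis
  proof
    show "hcomp M j \<subseteq> {0}"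
    proof
      fix x assume x: "x \<in> hcomp M j"
      then have "x \<in> S" using S graded_module_carrier(2)[OF M] by blast
      then show "x \<in> {0}" using component_homogeneous[OF ds x] j by (auto simp: S_def)
    qed
    show "{0} \<subseteq> hcomp M j" using add_subgroup_closed(1)[OF graded_module_carrier(3)[OF M]] by simp
  qed
qed

lemma module_mapD:
  assumes "module_map M L f" "graded_module M"
  shows "x \<in> carrier M \<Longrightarrow> f x \<in> carrier L"
    and "x \<in> carrier M \<Longrightarrow> y \<in> carrier M \<Longrightarrow> f (x + y) = f x + f y"
    and "x \<in> carrier M \<Longrightarrow> f (act M a x) = act L a (f x)"
    and "f 0 = 0"
    and "(\<And>i. i \<in> A \<Longrightarrow> g i \<in> carrier M) \<Longrightarrow> f (\<Sum>i\<in>A. g i) = (\<Sum>i\<in>A. f (g i))"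
proof -
  show add: "x \<in> carrier M \<Longrightarrow> y \<in> carrier M \<Longrightarrow> f (x + y) = f x + f y" for x y
    using assms(1) by (simp add: module_map_def)
  note sub = graded_module_carrier(1)[OF assms(2)]
  show "f 0 = 0" using sub add by (rule additive_zero)
  show "(\<And>i. i \<in> A \<Longrightarrow> g i \<in> carrier M) \<Longrightarrow> f (\<Sum>i\<in>A. g i) = (\<Sum>i\<in>A. f (g i))"
    by (rule additive_sum[OF sub add])
  show "x \<in> carrier M \<Longrightarrow> f x \<in> carrier L" "x \<in> carrier M \<Longrightarrow> f (act M a x) = act L a (f x)"
    using assms(1) by (auto simp: module_map_def)
qed

lemma graded_mapD:
  assumes "graded_map M L f"
  shows "module_map M L f" "x \<in> hcomp M i \<Longrightarrow> f x \<in> hcomp L i"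
  using assms by (auto simp: graded_map_def)

lemma graded_map_component:
  assumes "graded_map M L f" "graded_module M" "direct_sum_of (carrier L) (hcomp L)" "x \<in> carrier M"
  shows "component (hcomp L) (f x) i = f (component (hcomp M) x i)"
  using assms graded_mapD(2)[OF assms(1)] module_mapD(2)[OF graded_mapD(1)[OF assms(1)] assms(2)]
  by (intro component_map[OF graded_moduleD(1)]) auto

text \<open>
  As a function of \<open>f\<close> this is the module map from the free module that sends the unit vectors to the
  \<open>e k\<close>.
\<close>

definition comb :: "'a umod \<Rightarrow> nat \<Rightarrow> (nat \<Rightarrow> (nat \<Rightarrow> 'a)) \<Rightarrow> (nat \<Rightarrow> 'a) \<Rightarrow> (nat \<Rightarrow> 'a)" where
  "comb P b e f = (\<Sum>k<b. act P (f k) (e k))"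

definition unit_vec :: "nat \<Rightarrow> nat \<Rightarrow> 'a" where
  "unit_vec k = (\<lambda>l. if l = k then 1 else 0)"

lemma one_in_gr: "1 \<in> gr 0"
  unfolding connected by (rule range_eqI[of _ _ 1]) simp

lemma unit_vec_coords: "k < b \<Longrightarrow> unit_vec k \<in> coords b 0"
  using one_in_gr by (auto simp: unit_vec_def coords_def homog_def)

lemma comb_graded_map:
  assumes P: "graded_module P" and e: "\<And>k. k < b \<Longrightarrow> e k \<in> hcomp P \<nu>"
  shows "graded_map (free_module b \<nu>) P (comb P b e)"
  unfolding graded_map_def module_map_def
proof (intro conjI ballI allI)
  have ec: "e k \<in> carrier P" if "k < b" for k using e[OF that] by (rule graded_module_carrier(2)[OF P])
  note sub = graded_module_carrier(1)[OF P]
  show "comb P b e x \<in> carrier P" for x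
    unfolding comb_def using ec graded_moduleD(2)[OF P] by (intro add_subgroup_sum[OF sub]) auto
  show "comb P b e (x + y) = comb P b e x + comb P b e y" for x y
  proof -
    have "act P ((x + y) k) (e k) = act P (x k) (e k) + act P (y k) (e k)" if "k < b" for k
      using graded_moduleD(5)[OF P ec[OF that]] by (simp add: plus_fun_def[of x y])
    then show ?thesis by (simp add: comb_def flip: sum.distrib)
  qed
  show "comb P b e (act (free_module b \<nu>) a x) = act P a (comb P b e x)" for a x
  proof -
    have "act P a (comb P b e x) = (\<Sum>k<b. act P a (act P (x k) (e k)))"
      unfolding comb_def using ec graded_moduleD(2)[OF P] by (intro act_sum[OF P]) auto
    then show ?thesis using ec by (simp add: comb_def graded_moduleD(4)[OF P])
  qed
  show "comb P b e ` hcomp (free_module b \<nu>) i \<subseteq> hcomp P i" for i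
  proof
    fix x assume "x \<in> comb P b e ` hcomp (free_module b \<nu>) i"
    then obtain f where f: "f \<in> coords b (i - \<nu>)" "x = comb P b e f" by auto
    show "x \<in> hcomp P i"
      unfolding f(2) comb_def
    proof (rule add_subgroup_sum[OF graded_module_carrier(3)[OF P]])
      fix k assume k: "k \<in> {..<b}"
      have fk: "f k \<in> homog (i - \<nu>)" using f by (simp add: coords_def)
      show "act P (f k) (e k) \<in> hcomp P i"
      proof (cases "i - \<nu> \<ge> 0")
        case True
        then have "f k \<in> gr (nat (i - \<nu>))" using fk by (simp add: homog_def)
        from graded_moduleD(7)[OF P this e] k True show ?thesis by simp
      next
        case False
        then have "f k = 0" using fk by (simp add: homog_def)
        then show ?thesis
          using act_zero(1)[OF P] ec k add_subgroup_closed(1)[OF graded_module_carrier(3)[OF P]] by simp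
      qed
    qed
  qed
qed

lemma comb_unit_vec:
  assumes P: "graded_module P" and e: "\<And>k. k < b \<Longrightarrow> e k \<in> carrier P" and k: "k < b"
  shows "comb P b e (unit_vec k) = e k"
proof -
  have "comb P b e (unit_vec k) = (\<Sum>l<b. if l = k then e k else 0)"
    unfolding comb_def unit_vec_def
    using e act_zero(1)[OF P] graded_moduleD(3)[OF P] by (intro sum.cong) auto
  then show ?thesis using k by simp
qed

definition free_basis :: "'a umod \<Rightarrow> int \<Rightarrow> nat \<Rightarrow> (nat \<Rightarrow> (nat \<Rightarrow> 'a)) \<Rightarrow> bool" where
  "free_basis P \<nu> b e \<longleftrightarrow> (\<forall>k<b. e k \<in> hcomp P \<nu>) \<and> bij_betw (comb P b e) (carrier (free_module b \<nu>)) (carrier P)"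

text \<open>
  A basis of the degree \<open>\<nu>\<close> part defines a surjection from a free module, which splits by
  projectivity.  In degree \<open>\<nu>\<close> the surjection is already bijective, so the splitting sends the basis
  to the unit vectors and is a two-sided inverse.
\<close>

lemma free_basisI:
  assumes proj: "projective P" and gen: "generated_in_degree P \<nu>"
    and e: "\<And>k. k < b \<Longrightarrow> e k \<in> hcomp P \<nu>"
    and span: "\<And>x. x \<in> hcomp P \<nu> \<Longrightarrow> \<exists>c. x = (\<Sum>k<b. act P (scale (c k) 1) (e k))"
    and indep: "\<And>c k. (\<Sum>k<b. act P (scale (c k) 1) (e k)) = 0 \<Longrightarrow> k < b \<Longrightarrow> c k = 0"
  shows "free_basis P \<nu> b e"
proof -
  let ?F = "free_module b \<nu>" and ?\<phi> = "comb P b e"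
  have P: "graded_module P" using proj by (simp add: projective_def)
  have ec: "e k \<in> carrier P" if "k < b" for k using e[OF that] by (rule graded_module_carrier(2)[OF P])
  have \<phi>: "graded_map ?F P ?\<phi>" using P e by (rule comb_graded_map)
  note \<phi>D = module_mapD[OF graded_mapD(1)[OF \<phi>] free_module_graded]
  have surj: "?\<phi> ` carrier ?F = carrier P"
  proof -
    have "?\<phi> ` carrier ?F \<subseteq> carrier P" using \<phi>D(1) by blast
    moreover have "add_subgroup (?\<phi> ` carrier ?F)"
      unfolding add_subgroup_def
    proof (intro conjI ballI)
      show "0 \<in> ?\<phi> ` carrier ?F" by (rule image_eqI[of _ _ 0]) (simp_all add: \<phi>D(4))
      fix x y assume "x \<in> ?\<phi> ` carrier ?F" "y \<in> ?\<phi> ` carrier ?F"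
      then obtain f g where fg: "f \<in> carrier ?F" "g \<in> carrier ?F" "x = ?\<phi> f" "y = ?\<phi> g" by blast
      have d: "f - g \<in> carrier ?F" using fg by simp
      have "?\<phi> (f - g + g) = ?\<phi> (f - g) + ?\<phi> g" by (rule \<phi>D(2)[OF d fg(2)])
      then have "x - y = ?\<phi> (f - g)" using fg by simp
      then show "x - y \<in> ?\<phi> ` carrier ?F" using d by blast
    qed
    moreover have "\<forall>a. \<forall>x\<in>?\<phi> ` carrier ?F. act P a x \<in> ?\<phi> ` carrier ?F"
    proof (intro allI ballI)
      fix a x assume "x \<in> ?\<phi> ` carrier ?F"
      then obtain f where f: "f \<in> carrier ?F" "x = ?\<phi> f" by blast
      then have "act P a x = ?\<phi> (act ?F a f)" using \<phi>D(3) by simp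
      moreover have "act ?F a f \<in> carrier ?F" using f(1) by simp
      ultimately show "act P a x \<in> ?\<phi> ` carrier ?F" by blast
    qed
    moreover have "hcomp P \<nu> \<subseteq> ?\<phi> ` carrier ?F"
    proof
      fix x assume "x \<in> hcomp P \<nu>"
      from span[OF this] obtain c where c: "x = (\<Sum>k<b. act P (scale (c k) 1) (e k))" ..
      have "x = ?\<phi> (\<lambda>k. if k < b then scale (c k) 1 else 0)" by (simp add: c comb_def)
      moreover have "(\<lambda>k. if k < b then scale (c k) 1 else 0) \<in> carrier ?F" by simp
      ultimately show "x \<in> ?\<phi> ` carrier ?F" by blast
    qed
    ultimately show ?thesis using gen unfolding generated_in_degree_def by blast
  qed
  have "graded_map P P (\<lambda>x. x)" by (auto simp: graded_map_def module_map_def)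
  then obtain s where s: "graded_map P ?F s" and \<phi>s: "\<And>x. x \<in> carrier P \<Longrightarrow> ?\<phi> (s x) = x"
    using proj P free_module_graded \<phi> surj unfolding projective_def by blast
  note sD = module_mapD[OF graded_mapD(1)[OF s] P]
  have se: "s (e k) = unit_vec k" if k: "k < b" for k
  proof -
    have "s (e k) \<in> coords b 0" using graded_mapD(2)[OF s e[OF k]] by simp
    then have d: "s (e k) - unit_vec k \<in> coords b 0"
      using fv.subspace_diff[OF coords_subspace] unit_vec_coords[OF k] by blast
    then have "\<exists>c. (s (e k) - unit_vec k) l = scale c 1" for l
      using connected by (fastforce simp: coords_def homog_def)
    then obtain c where c: "\<And>l. (s (e k) - unit_vec k) l = scale (c l) 1" by metis
    have inF: "s (e k) - unit_vec k \<in> carrier ?F" "unit_vec k \<in> carrier ?F"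
      using d k by (auto simp: coords_def unit_vec_def)
    have "?\<phi> (s (e k) - unit_vec k + unit_vec k) = ?\<phi> (s (e k) - unit_vec k) + ?\<phi> (unit_vec k)"
      by (rule \<phi>D(2)[OF inF])
    then have "?\<phi> (s (e k) - unit_vec k) = 0"
      using \<phi>s[OF ec[OF k]] comb_unit_vec[of P b e k] P ec k by simp
    then have "(\<Sum>l<b. act P (scale (c l) 1) (e l)) = 0"
      by (simp add: comb_def c del: minus_apply)
    then have "c l = 0" if "l < b" for l using indep that by blast
    then have "(s (e k) - unit_vec k) l = 0" for l
      using c[of l] inF(1) by (cases "l < b") (auto simp del: minus_apply)
    then have "s (e k) l = unit_vec k l" for l using eq_iff_diff_eq_0[of "s (e k) l"] by simp
    then show ?thesis by (rule ext)
  qed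
  have inv: "s (?\<phi> f) = f" if f: "f \<in> carrier ?F" for f
  proof
    fix l
    have "s (?\<phi> f) = (\<Sum>k<b. s (act P (f k) (e k)))"
      unfolding comb_def using ec graded_moduleD(2)[OF P] by (intro sD(5)) auto
    also have "\<dots> = (\<Sum>k<b. (\<lambda>l. f k * unit_vec k l))"
      using ec se by (intro sum.cong) (auto simp: sD(3))
    finally have "s (?\<phi> f) l = (\<Sum>k<b. f k * unit_vec k l)" by (simp add: sum_fun_eval)
    also have "\<dots> = (\<Sum>k<b. if l = k then f k else 0)" by (intro sum.cong) (auto simp: unit_vec_def)
    also have "\<dots> = f l" using f by simp
    finally show "s (?\<phi> f) l = f l" .
  qed
  have "inj_on ?\<phi> (carrier ?F)" by (rule inj_on_inverseI[where g = s]) (rule inv)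
  then show ?thesis using e surj by (simp add: free_basis_def bij_betw_def)
qed

text \<open>
  The bijection with the free module respects the grading in both directions.
\<close>

lemma free_basis_hcomp:
  assumes P: "graded_module P" and fb: "free_basis P \<nu> b e" and f: "f \<in> carrier (free_module b \<nu>)"
  shows "comb P b e f \<in> hcomp P j \<longleftrightarrow> f \<in> coords b (j - \<nu>)"
proof
  let ?F = "free_module b \<nu>" and ?\<phi> = "comb P b e"
  have \<phi>: "graded_map ?F P ?\<phi>" using P fb by (intro comb_graded_map) (auto simp: free_basis_def)
  show "?\<phi> f \<in> hcomp P j" if "f \<in> coords b (j - \<nu>)"
    using graded_mapD(2)[OF \<phi>, of f j] that by simp
  assume h: "?\<phi> f \<in> hcomp P j"
  note ds = graded_moduleD(1)[OF free_module_graded, of b \<nu>]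
  have "?\<phi> (component (hcomp ?F) f j) = component (hcomp P) (?\<phi> f) j"
    using graded_map_component[OF \<phi> free_module_graded graded_moduleD(1)[OF P] f] ..
  also have "\<dots> = ?\<phi> f" using component_homogeneous[OF graded_moduleD(1)[OF P] h] by simp
  finally have "component (hcomp ?F) f j = f"
    using fb f component_in[OF ds f, of j] direct_sum_subgroup(4)[OF ds]
    unfolding free_basis_def bij_betw_def inj_on_def by metis
  then show "f \<in> coords b (j - \<nu>)" using component_in[OF ds f, of j] by simp
qed

text \<open>
  The degree \<open>\<nu>\<close> part is not a subspace of a vector space on a type.  Finite dimension is therefore
  expressed by an injective linear map \<open>g\<close> into the columns, with image in a finite-dimensional
  subspace; a basis of the image is pulled back.
\<close>

lemma free_basis_exists:
  assumes proj: "projective P" and gen: "generated_in_degree P \<nu>"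
    and add: "\<And>x y. x \<in> hcomp P \<nu> \<Longrightarrow> y \<in> hcomp P \<nu> \<Longrightarrow> g (x + y) = g x + g y"
    and lin: "\<And>c x. x \<in> hcomp P \<nu> \<Longrightarrow> g (act P (scale c 1) x) = fscale c (g x)"
    and inj: "\<And>x. x \<in> hcomp P \<nu> \<Longrightarrow> g x = 0 \<Longrightarrow> x = 0"
    and fin: "finite E" "g ` hcomp P \<nu> \<subseteq> fv.span E"
  shows "\<exists>b e. free_basis P \<nu> b e"
proof -
  have P: "graded_module P" using proj by (simp add: projective_def)
  note hsub = graded_module_carrier(3)[OF P, of \<nu>]
  have scale_in: "act P (scale c 1) x \<in> hcomp P \<nu>" if "x \<in> hcomp P \<nu>" for c x
    using graded_moduleD(7)[OF P, of "scale c 1" 0 x \<nu>] that by (simp add: connected)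
  have g_comb: "g (\<Sum>k\<in>A. act P (scale (c k) 1) (e k)) = (\<Sum>k\<in>A. fscale (c k) (g (e k)))"
    if "\<And>k. k \<in> A \<Longrightarrow> e k \<in> hcomp P \<nu>" for A :: "nat set" and c e
  proof -
    have "g (\<Sum>k\<in>A. act P (scale (c k) 1) (e k)) = (\<Sum>k\<in>A. g (act P (scale (c k) 1) (e k)))"
      by (rule additive_sum[where f = g and S = "hcomp P \<nu>", OF hsub]) (simp_all add: add scale_in that)
    then show ?thesis by (simp add: lin that)
  qed
  have g_inj: "x = y" if "x \<in> hcomp P \<nu>" "y \<in> hcomp P \<nu>" "g x = g y" for x y
  proof -
    have d: "x - y \<in> hcomp P \<nu>" using that hsub by (simp add: add_subgroup_closed)
    have "g (x - y) = 0" using add[OF d that(2)] that(3) by simp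
    from inj[OF d this] show ?thesis by simp
  qed
  obtain B where B: "B \<subseteq> g ` hcomp P \<nu>" "fv.independent B" "g ` hcomp P \<nu> \<subseteq> fv.span B"
    by (rule fv.maximal_independent_subset)
  have finB: "finite B"
    using fv.independent_span_bound[OF fin(1) B(2)] B(1) fin(2) by blast
  obtain \<beta> where \<beta>: "bij_betw \<beta> {..<card B} B"
    using finB by (metis bij_betw_from_nat_into_finite)
  define e where "e k = (SOME x. x \<in> hcomp P \<nu> \<and> g x = \<beta> k)" for k
  have e: "e k \<in> hcomp P \<nu>" "g (e k) = \<beta> k" if "k < card B" for k
  proof -
    have "\<beta> k \<in> B" using that \<beta> by (auto simp: bij_betw_def)
    then have "\<exists>x. x \<in> hcomp P \<nu> \<and> g x = \<beta> k" using B(1) by (metis (no_types) imageE subsetD)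
    from someI_ex[OF this] show "e k \<in> hcomp P \<nu>" "g (e k) = \<beta> k" by (auto simp: e_def)
  qed
  have "free_basis P \<nu> (card B) e"
  proof (rule free_basisI[OF proj gen e(1)])
    fix x assume x: "x \<in> hcomp P \<nu>"
    then have "g x \<in> fv.span B" using B(3) by auto
    then obtain u where "g x = (\<Sum>v\<in>B. fscale (u v) v)"
      using fv.span_finite[OF finB] by auto
    also have "\<dots> = (\<Sum>k<card B. fscale (u (\<beta> k)) (g (e k)))"
      using sum.reindex_bij_betw[OF \<beta>, of "\<lambda>v. fscale (u v) v"] e(2) by simp
    also have "\<dots> = g (\<Sum>k<card B. act P (scale (u (\<beta> k)) 1) (e k))"
      using e(1) by (intro g_comb[symmetric]) auto
    finally have gx: "g x = g (\<Sum>k<card B. act P (scale (u (\<beta> k)) 1) (e k))" .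
    have "(\<Sum>k<card B. act P (scale (u (\<beta> k)) 1) (e k)) \<in> hcomp P \<nu>"
      using e(1) scale_in by (intro add_subgroup_sum[OF hsub]) auto
    from g_inj[OF x this gx]
    have "x = (\<Sum>k<card B. act P (scale (u (\<beta> k)) 1) (e k))" .
    then show "\<exists>c. x = (\<Sum>k<card B. act P (scale (c k) 1) (e k))" by (rule exI[of _ "\<lambda>k. u (\<beta> k)"])
  next
    fix c k assume z: "(\<Sum>k<card B. act P (scale (c k) 1) (e k)) = 0" and k: "k < card B"
    have g0: "g 0 = 0" by (rule additive_zero[where f = g and S = "hcomp P \<nu>", OF hsub]) (rule add)
    define u where "u v = c (the_inv_into {..<card B} \<beta> v)" for v
    have u: "u (\<beta> k) = c k" if "k < card B" for k
      using that \<beta> by (simp add: u_def the_inv_into_f_f bij_betw_def)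
    have "(\<Sum>v\<in>B. fscale (u v) v) = (\<Sum>k<card B. fscale (c k) (g (e k)))"
      using sum.reindex_bij_betw[OF \<beta>, of "\<lambda>v. fscale (u v) v"] e(2) u by simp
    also have "\<dots> = g (\<Sum>k<card B. act P (scale (c k) 1) (e k))"
      using e(1) by (intro g_comb[symmetric]) auto
    also have "\<dots> = 0" using z g0 by simp
    finally have "u (\<beta> k) = 0"
      using fv.independentD[OF B(2) finB subset_refl, of u "\<beta> k"] \<beta> k by (auto simp: bij_betw_def)
    then show "c k = 0" using u k by simp
  qed
  then show ?thesis by blast
qed

lemma homog_finite_dim: "\<exists>B. finite B \<and> homog j \<subseteq> span B"
  using locally_finite[of "nat j"] by (auto simp: homog_def intro: exI[of _ "{}"])

lemma coords_finite_dim: "\<exists>B. finite B \<and> coords b j \<subseteq> fv.span B"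
proof -
  obtain B where B: "finite B" "homog j \<subseteq> span B" using homog_finite_dim by blast
  define u where "u k x = (\<lambda>l. if l = k then x else 0)" for k :: nat and x :: 'a
  have lin: "Vector_Spaces.linear scale fscale (u k)" for k
    using vector_space_axioms vector_space_fscale
    by (auto simp: Vector_Spaces.linear_iff u_def fscale_def plus_fun_def)
  have "f \<in> fv.span (\<Union>k<b. u k ` B)" if f: "f \<in> coords b j" for f
  proof -
    have "f = (\<Sum>k<b. u k (f k))"
    proof
      fix l
      have "(\<Sum>k<b. u k (f k)) l = (\<Sum>k<b. if l = k then f k else 0)"
        unfolding sum_fun_eval by (intro sum.cong) (auto simp: u_def)
      also have "\<dots> = f l" using f by (simp add: coords_def)
      finally show "f l = (\<Sum>k<b. u k (f k)) l" ..
    qed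
    also have "\<dots> \<in> fv.span (\<Union>k<b. u k ` B)"
    proof (rule fv.span_sum)
      fix k assume k: "k \<in> {..<b}"
      interpret u: Vector_Spaces.linear scale fscale "u k" by (rule lin)
      have "f k \<in> span B" using f B(2) by (auto simp: coords_def)
      then have "u k (f k) \<in> fv.span (u k ` B)" by (simp add: u.span_image)
      then show "u k (f k) \<in> fv.span (\<Union>k<b. u k ` B)"
        using fv.span_mono[of "u k ` B" "\<Union>k<b. u k ` B"] k by blast
    qed
    finally show ?thesis .
  qed
  moreover have "finite (\<Union>k<b. u k ` B)" using B(1) by simp
  ultimately show ?thesis by blast
qed

lemma dim_zero: "dim {0} = 0"
  using dim_unique[of "{}" "{0}" 0] independent_empty by simp

lemma fdim_zero: "fv.dim {0} = 0"
  using fv.dim_unique[of "{}" "{0}" 0] fv.independent_empty by simp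

text \<open>
  Induction on \<open>b\<close>, applying rank-nullity to the last coordinate.
\<close>

lemma dim_coords: "fv.dim (coords b j) = b * dim (homog j)"
proof (induction b)
  case 0
  have "coords 0 j = {0}" using subspace_0[OF homog_subspace] by (auto simp: coords_def)
  then show ?case by (simp add: fdim_zero)
next
  case (Suc b)
  have lin: "Vector_Spaces.linear fscale scale (\<lambda>f. f b)"
    using vector_space_axioms vector_space_fscale by (auto simp: Vector_Spaces.linear_iff fscale_def plus_fun_def)
  have "{f \<in> coords (Suc b) j. f b = 0} = coords b j"
    by (auto simp: coords_def) (metis Suc_leI le_neq_implies_less)
  moreover have "(\<lambda>f. f b) ` coords (Suc b) j = homog j"
  proof
    show "homog j \<subseteq> (\<lambda>f. f b) ` coords (Suc b) j"
    proof
      fix x assume "x \<in> homog j"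
      then have "(\<lambda>l. if l = b then x else 0) \<in> coords (Suc b) j"
        using subspace_0[OF homog_subspace] by (auto simp: coords_def)
      then show "x \<in> (\<lambda>f. f b) ` coords (Suc b) j" by (rule rev_image_eqI) simp
    qed
  qed (auto simp: coords_def)
  moreover obtain B where "finite B" "coords (Suc b) j \<subseteq> fv.span B" using coords_finite_dim by blast
  ultimately show ?case
    using fs.rank_nullity[OF lin coords_subspace] Suc by simp
qed

definition coord :: "'a umod \<Rightarrow> int \<Rightarrow> nat \<Rightarrow> (nat \<Rightarrow> (nat \<Rightarrow> 'a)) \<Rightarrow> (nat \<Rightarrow> 'a) \<Rightarrow> (nat \<Rightarrow> 'a)" where
  "coord P \<nu> b e = inv_into (carrier (free_module b \<nu>)) (comb P b e)"

lemma coord_inverse: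
  assumes "free_basis P \<nu> b e"
  shows "f \<in> carrier (free_module b \<nu>) \<Longrightarrow> coord P \<nu> b e (comb P b e f) = f"
    and "x \<in> carrier P \<Longrightarrow> comb P b e (coord P \<nu> b e x) = x"
    and "x \<in> carrier P \<Longrightarrow> coord P \<nu> b e x \<in> carrier (free_module b \<nu>)"
  using assms bij_betw_inv_into_left[of "comb P b e"] bij_betw_inv_into_right[of "comb P b e"]
    bij_betw_apply[OF bij_betw_inv_into, of "comb P b e"]
  unfolding free_basis_def coord_def by blast+

lemma coord_graded_map:
  assumes P: "graded_module P" and fb: "free_basis P \<nu> b e"
  shows "graded_map P (free_module b \<nu>) (coord P \<nu> b e)"
  unfolding graded_map_def module_map_def
proof (intro conjI ballI allI)
  let ?F = "free_module b \<nu>" and ?\<phi> = "comb P b e" and ?\<psi> = "coord P \<nu> b e"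
  have \<phi>: "graded_map ?F P ?\<phi>" using P fb by (intro comb_graded_map) (auto simp: free_basis_def)
  note \<phi>D = module_mapD[OF graded_mapD(1)[OF \<phi>] free_module_graded]
  note inv = coord_inverse[OF fb]
  note FD = graded_moduleD[OF free_module_graded]
  show in_F: "?\<psi> x \<in> carrier ?F" if "x \<in> carrier P" for x using inv(3) that .
  show "?\<psi> (x + y) = ?\<psi> x + ?\<psi> y" if xy: "x \<in> carrier P" "y \<in> carrier P" for x y
  proof -
    have "?\<psi> x + ?\<psi> y \<in> carrier ?F"
      by (intro add_subgroup_closed(4)[OF graded_module_carrier(1)[OF free_module_graded]] in_F xy)
    moreover have "?\<phi> (?\<psi> x + ?\<psi> y) = x + y"
      using \<phi>D(2)[OF in_F in_F] inv(2) xy by simp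
    ultimately show ?thesis using inv(1) by metis
  qed
  show "?\<psi> (act P a x) = act ?F a (?\<psi> x)" if x: "x \<in> carrier P" for a x
  proof -
    have "act ?F a (?\<psi> x) \<in> carrier ?F" by (intro FD(2) in_F x)
    moreover have "?\<phi> (act ?F a (?\<psi> x)) = act P a x"
      using \<phi>D(3)[OF in_F] inv(2) x by simp
    ultimately show ?thesis using inv(1) by metis
  qed
  show "?\<psi> ` hcomp P j \<subseteq> hcomp ?F j" for j
  proof
    fix f assume "f \<in> ?\<psi> ` hcomp P j"
    then obtain x where x: "x \<in> hcomp P j" "f = ?\<psi> x" by blast
    then have xc: "x \<in> carrier P" using graded_module_carrier(2)[OF P] by blast
    show "f \<in> hcomp ?F j"
      using free_basis_hcomp[OF P fb in_F[OF xc], of j] x inv(2)[OF xc] by simp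
  qed
qed

lemma coord_hcomp_bij:
  assumes P: "graded_module P" and fb: "free_basis P \<nu> b e"
  shows "comb P b e ` coords b (j - \<nu>) = hcomp P j"
proof
  show "comb P b e ` coords b (j - \<nu>) \<subseteq> hcomp P j"
    using free_basis_hcomp[OF P fb] by (auto simp: coords_def)
  show "hcomp P j \<subseteq> comb P b e ` coords b (j - \<nu>)"
  proof
    fix x assume x: "x \<in> hcomp P j"
    have "coord P \<nu> b e x \<in> coords b (j - \<nu>)"
      using graded_mapD(2)[OF coord_graded_map[OF P fb] x] by simp
    moreover have "x = comb P b e (coord P \<nu> b e x)"
      using coord_inverse(2)[OF fb] graded_module_carrier(2)[OF P x] by simp
    ultimately show "x \<in> comb P b e ` coords b (j - \<nu>)" by blast
  qed
qed

text \<open>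
  Replace a preimage by its component in degree \<open>n\<close>.
\<close>

lemma homogeneous_preimage:
  assumes f: "graded_map M L f" and M: "graded_module M" and L: "direct_sum_of (carrier L) (hcomp L)"
    and x: "x \<in> hcomp L n" "x \<in> f ` carrier M"
  shows "x \<in> f ` hcomp M n"
proof -
  obtain y where y: "y \<in> carrier M" "x = f y" using x(2) by blast
  have "f (component (hcomp M) y n) = component (hcomp L) x n"
    using graded_map_component[OF f M L y(1)] y(2) by simp
  also have "\<dots> = x" using component_homogeneous[OF L x(1)] by simp
  finally show ?thesis using component_in[OF graded_moduleD(1)[OF M] y(1), of n] by blast
qed

section \<open>The minimal resolution of the trivial module\<close>

lemma A_plus_subspace: "subspace A_plus"
  by (simp add: A_plus_def)

lemma gr_subset_A_plus: "n \<ge> 1 \<Longrightarrow> gr n \<subseteq> A_plus"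
  unfolding A_plus_def using span_superset[of "\<Union>n\<in>{1..}. gr n"] by blast

lemma component_scale: "component gr (scale c x) i = scale c (component gr x i)"
  using subspace_scale[OF gr_subspace]
  by (intro component_map[OF gr_direct_sum gr_direct_sum]) (auto simp: scale_right_distrib)

lemma one_notin_A_plus: "1 \<notin> A_plus"
proof
  assume "1 \<in> A_plus"
  have "A_plus \<subseteq> {x. component gr x 0 = 0}"
    unfolding A_plus_def
  proof (rule span_minimal)
    show "(\<Union>n\<in>{1..}. gr n) \<subseteq> {x. component gr x 0 = 0}"
      using component_homogeneous[OF gr_direct_sum] by fastforce
    show "subspace {x. component gr x 0 = 0}"
      using component_homogeneous[OF gr_direct_sum zero_in_gr, of 0] component_add[OF gr_direct_sum]
      by (auto simp: subspace_def component_scale)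
  qed
  then have "component gr 1 0 = 0" using \<open>1 \<in> A_plus\<close> by blast
  then show False using component_homogeneous[OF gr_direct_sum one_in_gr] by simp
qed

lemma A_plus_mult_right: "a \<in> A_plus \<Longrightarrow> a * x \<in> A_plus"
proof -
  assume a: "a \<in> A_plus"
  have hom: "a * x \<in> A_plus" if "a \<in> gr n" "n \<ge> 1" for a n
  proof (rule direct_sum_induct[OF gr_direct_sum, of x "\<lambda>x. a * x \<in> A_plus"])
    show "a * 0 \<in> A_plus" using subspace_0[OF A_plus_subspace] by simp
    show "a * (x + y) \<in> A_plus" if "a * x \<in> A_plus" "a * y \<in> A_plus" for x y
      using subspace_add[OF A_plus_subspace that] by (simp add: distrib_left)
    show "a * y \<in> A_plus" if "y \<in> gr m" for y m
      using gr_mult[OF \<open>a \<in> gr n\<close> that] gr_subset_A_plus[of "n + m"] \<open>n \<ge> 1\<close> by auto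
  qed simp
  have "subspace {a. a * x \<in> A_plus}"
    using A_plus_subspace by (auto simp: subspace_def distrib_right scale_mult_left)
  from span_minimal[OF _ this, of "\<Union>n\<in>{1..}. gr n"] hom
  have "A_plus \<subseteq> {a. a * x \<in> A_plus}" unfolding A_plus_def[symmetric] by auto
  then show "a * x \<in> A_plus" using a by blast
qed

lemma augmentation_scale_one: "augmentation (scale c 1) = c"
  unfolding augmentation_def
proof (rule the_equality)
  show "scale c 1 - scale c 1 \<in> A_plus" using subspace_0[OF A_plus_subspace] by simp
  fix c' assume "scale c 1 - scale c' 1 \<in> A_plus"
  then have "scale (c - c') 1 \<in> A_plus" by (simp add: scale_left_diff_distrib)
  then have *: "scale (inverse (c - c')) (scale (c - c') 1) \<in> A_plus"
    by (rule subspace_scale[OF A_plus_subspace])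
  show "c' = c"
  proof (rule ccontr)
    assume "c' \<noteq> c"
    then show False using * one_notin_A_plus by simp
  qed
qed

lemma trivial_module_simps [simp]:
  "carrier trivial_module = UNIV" "act trivial_module a c = augmentation a * c"
  "hcomp trivial_module i = (if i = 0 then UNIV else {0})"
  by (simp_all add: trivial_module_def)

lemma trivial_module_direct_sum: "direct_sum_of (carrier trivial_module) (hcomp trivial_module)"
proof (rule direct_sum_ofI[where pr = "\<lambda>x (i::int). if i = 0 then x else 0"])
  show "\<exists>A. finite A \<and> (\<forall>i::int. i \<notin> A \<longrightarrow> (if i = 0 then x else 0) = 0) \<and> x = (\<Sum>i\<in>A. if i = 0 then x else 0)"
    for x :: 'k
    by (rule exI[of _ "{0 :: int}"]) simp
qed (auto simp: add_subgroup_def split: if_splits)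

text \<open>
  By induction each term has a finite-dimensional generating part: the differential embeds the
  degree \<open>\<nu> (i + 1)\<close> part of \<open>P (i + 1)\<close> into \<open>P i\<close>, since its kernel there is the image of the
  degree \<open>\<nu> (i + 1)\<close> part of \<open>P (i + 2)\<close>, which is generated in higher degree and so vanishes in
  degree \<open>\<nu> (i + 1)\<close>.  The coordinates of \<open>P i\<close> make this an embedding into columns.
\<close>

lemma resolution_free:
  assumes res: "projective_resolution trivial_module P \<delta> \<epsilon>"
    and gen: "\<And>i. generated_in_degree (P i) (int (\<nu> i))"
    and \<nu>: "\<nu> 0 = 0" "\<And>i. \<nu> i < \<nu> (Suc i)"
  shows "\<exists>b e. free_basis (P i) (int (\<nu> i)) b e"
proof -
  have proj: "projective (P i)" for i using res by (simp add: projective_resolution_def)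
  then have gm: "graded_module (P i)" for i by (simp add: projective_def)
  have \<delta>: "graded_map (P (Suc i)) (P i) (\<delta> i)" for i using res by (simp add: projective_resolution_def)
  have \<epsilon>: "graded_map (P 0) trivial_module \<epsilon>" using res by (simp add: projective_resolution_def)
  have ker0: "kernel_of (P 0) \<epsilon> = \<delta> 0 ` carrier (P 1)"
    and ker: "kernel_of (P (Suc i)) (\<delta> i) = \<delta> (Suc i) ` carrier (P (Suc (Suc i)))" for i
    using res by (auto simp: projective_resolution_def)
  have bound0: "x = 0" if x: "x \<in> hcomp (P i) (int (\<nu> i))" "x \<in> \<delta> i ` carrier (P (Suc i))" for i x
  proof -
    have "x \<in> \<delta> i ` hcomp (P (Suc i)) (int (\<nu> i))"
      by (rule homogeneous_preimage[OF \<delta> gm graded_moduleD(1)[OF gm] x])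
    moreover have "hcomp (P (Suc i)) (int (\<nu> i)) = {0}"
      using generated_in_degree_vanish[OF gm gen] \<nu>(2)[of i] by simp
    moreover have "\<delta> i 0 = 0" by (rule module_mapD(4)[OF graded_mapD(1)[OF \<delta>] gm])
    ultimately show ?thesis by auto
  qed
  show ?thesis
  proof (induction i)
    case 0
    note \<epsilon>D = module_mapD[OF graded_mapD(1)[OF \<epsilon>] gm]
    have c: "x \<in> carrier (P 0)" if "x \<in> hcomp (P 0) (int (\<nu> 0))" for x
      using that by (rule graded_module_carrier(2)[OF gm])
    show ?case
    proof (rule free_basis_exists[OF proj gen, where g = "\<lambda>x. fscale (\<epsilon> x) (unit_vec 0)" and E = "{unit_vec 0}"])
      show "fscale (\<epsilon> (x + y)) (unit_vec 0) = fscale (\<epsilon> x) (unit_vec 0) + fscale (\<epsilon> y) (unit_vec 0)"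
        if "x \<in> hcomp (P 0) (int (\<nu> 0))" "y \<in> hcomp (P 0) (int (\<nu> 0))" for x y
        using \<epsilon>D(2)[OF c c] that by (simp add: fv.scale_left_distrib)
      show "fscale (\<epsilon> (act (P 0) (scale r 1) x)) (unit_vec 0) = fscale r (fscale (\<epsilon> x) (unit_vec 0))"
        if "x \<in> hcomp (P 0) (int (\<nu> 0))" for r x
        using \<epsilon>D(3)[OF c[OF that]] by (simp add: augmentation_scale_one)
      show "x = 0" if x: "x \<in> hcomp (P 0) (int (\<nu> 0))" and z: "fscale (\<epsilon> x) (unit_vec 0) = 0" for x
      proof -
        have "fscale (\<epsilon> x) (unit_vec 0) 0 = 0" using fun_cong[OF z, of 0] by simp
        then have "\<epsilon> x = 0" by (simp add: fscale_def unit_vec_def)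
        then have "x \<in> \<delta> 0 ` carrier (P 1)" unfolding ker0[symmetric] by (simp add: kernel_of_def c[OF x])
        then show ?thesis using bound0[OF x] by simp
      qed
      show "(\<lambda>x. fscale (\<epsilon> x) (unit_vec 0)) ` hcomp (P 0) (int (\<nu> 0)) \<subseteq> fv.span {unit_vec 0}"
        by (auto intro: fv.span_scale fv.span_base)
    qed simp
  next
    case (Suc i)
    then obtain b e where fb: "free_basis (P i) (int (\<nu> i)) b e" by blast
    let ?\<psi> = "coord (P i) (int (\<nu> i)) b e" and ?H = "hcomp (P (Suc i)) (int (\<nu> (Suc i)))"
    note \<psi> = coord_graded_map[OF gm fb]
    have comb: "graded_map (free_module b (int (\<nu> i))) (P i) (comb (P i) b e)"
      using fb by (intro comb_graded_map[OF gm]) (auto simp: free_basis_def)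
    note \<psi>D = module_mapD[OF graded_mapD(1)[OF \<psi>] gm]
    note \<delta>D = module_mapD[OF graded_mapD(1)[OF \<delta>] gm]
    have c: "x \<in> carrier (P (Suc i))" if "x \<in> ?H" for x
      using that by (rule graded_module_carrier(2)[OF gm])
    obtain B where B: "finite B" "coords b (int (\<nu> (Suc i)) - int (\<nu> i)) \<subseteq> fv.span B"
      using coords_finite_dim by blast
    show ?case
    proof (rule free_basis_exists[OF proj gen, where g = "\<lambda>x. ?\<psi> (\<delta> i x)" and E = B])
      show "?\<psi> (\<delta> i (x + y)) = ?\<psi> (\<delta> i x) + ?\<psi> (\<delta> i y)" if "x \<in> ?H" "y \<in> ?H" for x y
        using \<delta>D(2)[OF c c] \<psi>D(2)[OF \<delta>D(1) \<delta>D(1)] c that by simp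
      show "?\<psi> (\<delta> i (act (P (Suc i)) (scale r 1) x)) = fscale r (?\<psi> (\<delta> i x))" if "x \<in> ?H" for r x
        using \<delta>D(3)[OF c[OF that]] \<psi>D(3)[OF \<delta>D(1)[OF c[OF that]]] by (simp add: fscale_def)
      show "x = 0" if x: "x \<in> ?H" and z: "?\<psi> (\<delta> i x) = 0" for x
      proof -
        have "\<delta> i x = comb (P i) b e (?\<psi> (\<delta> i x))" using coord_inverse(2)[OF fb \<delta>D(1)[OF c[OF x]]] ..
        also have "\<dots> = 0" unfolding z by (rule module_mapD(4)[OF graded_mapD(1)[OF comb] free_module_graded])
        finally have "x \<in> \<delta> (Suc i) ` carrier (P (Suc (Suc i)))"
          unfolding ker[symmetric] by (simp add: kernel_of_def c[OF x])
        then show ?thesis using bound0[OF x] by simp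
      qed
      show "(\<lambda>x. ?\<psi> (\<delta> i x)) ` ?H \<subseteq> fv.span B"
        using graded_mapD(2)[OF \<psi> graded_mapD(2)[OF \<delta>]] B(2) by auto
    qed (rule B(1))
  qed
qed

lemma dim_gr_0: "dim (gr 0) = 1"
proof (rule dim_unique)
  show "{1} \<subseteq> gr 0" using one_in_gr by simp
  show "gr 0 \<subseteq> span {1}" unfolding connected by (auto intro: span_scale span_base)
  show "independent {1 :: 'a}" by simp
qed simp

lemma alternating_telescope:
  fixes r :: "nat \<Rightarrow> int"
  shows "(\<Sum>i\<le>n. (-1) ^ i * (r i + r (Suc i))) = r 0 + (-1) ^ n * r (Suc n)"
  by (induction n) (simp_all add: algebra_simps)

text \<open>
  In degree \<open>n\<close> the resolution is an exact complex of finite-dimensional spaces \<open>X i\<close> that ends in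
  the degree \<open>n\<close> part of the trivial module.  If \<open>r i\<close> is the rank of the map leaving \<open>X i\<close>, exactness
  gives \<open>dim (X i) = r i + r (i + 1)\<close>, and the alternating sum telescopes.  It may stop at \<open>n\<close>
  because \<open>\<nu> i \<ge> i\<close>.
\<close>

lemma resolution_euler_characteristic:
  assumes res: "projective_resolution trivial_module P \<delta> \<epsilon>"
    and fb: "\<And>i. free_basis (P i) (int (\<nu> i)) (b i) (e i)"
    and \<nu>: "\<nu> 0 = 0" "\<And>i. \<nu> i < \<nu> (Suc i)"
  shows "(\<Sum>i\<le>n. (-1) ^ i * int (b i * (if \<nu> i \<le> n then dim (gr (n - \<nu> i)) else 0))) = (if n = 0 then 1 else 0)"
proof -
  have gm: "graded_module (P i)" for i using res by (simp add: projective_resolution_def projective_def)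
  have \<delta>: "graded_map (P (Suc i)) (P i) (\<delta> i)" for i using res by (simp add: projective_resolution_def)
  have \<epsilon>: "graded_map (P 0) trivial_module \<epsilon>" and \<epsilon>_surj: "\<epsilon> ` carrier (P 0) = UNIV"
    using res by (simp_all add: projective_resolution_def)
  have ker0: "kernel_of (P 0) \<epsilon> = \<delta> 0 ` carrier (P 1)"
    and ker: "kernel_of (P (Suc i)) (\<delta> i) = \<delta> (Suc i) ` carrier (P (Suc (Suc i)))" for i
    using res by (auto simp: projective_resolution_def)
  note \<delta>D = module_mapD[OF graded_mapD(1)[OF \<delta>] gm] and \<epsilon>D = module_mapD[OF graded_mapD(1)[OF \<epsilon>] gm]
  define \<phi> where "\<phi> i f = comb (P i) (b i) (e i) (\<lambda>k. if k < b i then f k else 0)" for i f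
  define \<psi> where "\<psi> i = coord (P i) (int (\<nu> i)) (b i) (e i)" for i
  let ?F = "\<lambda>i. free_module (b i) (int (\<nu> i))"
  have comb: "graded_map (?F i) (P i) (comb (P i) (b i) (e i))" for i
    using fb[of i] by (intro comb_graded_map[OF gm]) (auto simp: free_basis_def)
  note combD = module_mapD[OF graded_mapD(1)[OF comb] free_module_graded]
  have \<phi>_coords: "\<phi> i f = comb (P i) (b i) (e i) f" if "f \<in> carrier (?F i)" for i f
  proof -
    have "(\<lambda>k. if k < b i then f k else 0) = f" using that by auto
    then show ?thesis by (simp add: \<phi>_def)
  qed
  have \<phi>_in: "\<phi> i f \<in> carrier (P i)" for i f
    unfolding \<phi>_def by (rule combD(1)) simp
  have \<phi>_add: "\<phi> i (f + g) = \<phi> i f + \<phi> i g" for i f g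
  proof -
    have "(\<lambda>k. if k < b i then (f + g) k else 0) = (\<lambda>k. if k < b i then f k else 0) + (\<lambda>k. if k < b i then g k else 0)"
      by (auto simp: plus_fun_def)
    then show ?thesis unfolding \<phi>_def by (simp only:) (rule combD(2); simp)
  qed
  have \<phi>_scale: "\<phi> i (fscale c f) = act (P i) (scale c 1) (\<phi> i f)" for i c f
  proof -
    have "(\<lambda>k. if k < b i then fscale c f k else 0) = act (?F i) (scale c 1) (\<lambda>k. if k < b i then f k else 0)"
      by (auto simp: fscale_def)
    then show ?thesis unfolding \<phi>_def by (simp only:) (rule combD(3); simp)
  qed
  note \<psi>D = module_mapD[OF graded_mapD(1)[OF coord_graded_map[OF gm fb]] gm, folded \<psi>_def]
  note \<psi>_inv = coord_inverse[OF fb, folded \<psi>_def]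
  define X where "X i = coords (b i) (int n - int (\<nu> i))" for i
  have X_sub: "X i \<subseteq> carrier (?F i)" for i by (auto simp: X_def coords_def)
  have \<phi>_X: "\<phi> i ` X i = hcomp (P i) (int n)" for i
  proof -
    have "\<phi> i ` X i = comb (P i) (b i) (e i) ` X i" by (intro image_cong \<phi>_coords subsetD[OF X_sub]) simp_all
    then show ?thesis unfolding X_def using coord_hcomp_bij[OF gm fb] by simp
  qed
  have \<psi>_\<phi>: "\<psi> i (\<phi> i f) = f" if "f \<in> carrier (?F i)" for i f
    using \<psi>_inv(1)[OF that] \<phi>_coords[OF that] by simp
  have \<phi>_\<psi>: "\<phi> i (\<psi> i x) = x" if "x \<in> carrier (P i)" for i x
    using \<psi>_inv(2)[OF that] \<phi>_coords[OF \<psi>_inv(3)[OF that]] by simp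
  have \<psi>_hcomp: "\<psi> i ` hcomp (P i) (int n) = X i" for i
    unfolding \<phi>_X[symmetric] image_image using \<psi>_\<phi> X_sub by (force simp del: free_module_simps)
  \<comment> \<open>\<open>D\<close> are the differentials and \<open>E\<close> is the augmentation in coordinates; truncating columns in \<open>\<phi>\<close>
    makes them linear on all columns.\<close>
  define D where "D i f = \<psi> i (\<delta> i (\<phi> (Suc i) f))" for i f
  define E where "E f = scale (\<epsilon> (\<phi> 0 f)) 1" for f
  have linD: "Vector_Spaces.linear fscale fscale (D i)" for i
  proof -
    have "D i (f + g) = D i f + D i g" for f g
      unfolding D_def \<phi>_add \<delta>D(2)[OF \<phi>_in \<phi>_in] by (rule \<psi>D(2)) (simp_all add: \<delta>D(1) \<phi>_in)
    moreover have "D i (fscale c f) = fscale c (D i f)" for c f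
      unfolding D_def \<phi>_scale \<delta>D(3)[OF \<phi>_in] \<psi>D(3)[OF \<delta>D(1)[OF \<phi>_in]]
      by (simp add: fscale_def)
    ultimately show ?thesis using vector_space_fscale by (simp add: Vector_Spaces.linear_iff)
  qed
  have linE: "Vector_Spaces.linear fscale scale E"
  proof -
    have "E (f + g) = E f + E g" for f g
      unfolding E_def \<phi>_add \<epsilon>D(2)[OF \<phi>_in \<phi>_in] by (rule scale_left_distrib)
    moreover have "E (fscale c f) = scale c (E f)" for c f
      unfolding E_def \<phi>_scale \<epsilon>D(3)[OF \<phi>_in] by (simp add: augmentation_scale_one)
    ultimately show ?thesis using vector_space_fscale vector_space_axioms by (simp add: Vector_Spaces.linear_iff)
  qed
  have image_D: "D i ` X (Suc i) = \<psi> i ` (\<delta> i ` hcomp (P (Suc i)) (int n))" for i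
    unfolding D_def \<phi>_X[symmetric] image_image ..
  have homog_ker: "\<delta> i ` hcomp (P (Suc i)) (int n) = {x \<in> hcomp (P i) (int n). x \<in> \<delta> i ` carrier (P (Suc i))}" for i
    using homogeneous_preimage[OF \<delta> gm graded_moduleD(1)[OF gm]] graded_mapD(2)[OF \<delta>] graded_module_carrier(2)[OF gm]
    by blast
  have D_zero: "D i f = 0 \<longleftrightarrow> \<delta> i (\<phi> (Suc i) f) = 0" for i f
  proof
    assume "D i f = 0"
    then have "\<phi> i (D i f) = \<phi> i 0" by simp
    moreover have "\<phi> i 0 = 0" using \<phi>_add[of i 0 0] by simp
    ultimately show "\<delta> i (\<phi> (Suc i) f) = 0" unfolding D_def using \<phi>_\<psi>[OF \<delta>D(1)[OF \<phi>_in]] by simp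
  qed (simp add: D_def \<psi>D(4))
  have exact0: "D 0 ` X 1 = {f \<in> X 0. E f = 0}"
  proof -
    have "D 0 ` X 1 = \<psi> 0 ` {x \<in> hcomp (P 0) (int n). \<epsilon> x = 0}"
    proof -
      have "{x \<in> hcomp (P 0) (int n). x \<in> \<delta> 0 ` carrier (P 1)} = {x \<in> hcomp (P 0) (int n). \<epsilon> x = 0}"
        unfolding ker0[symmetric] kernel_of_def using graded_module_carrier(2)[OF gm[of 0]] by blast
      then show ?thesis using image_D[of 0] homog_ker[of 0] by simp
    qed
    also have "\<dots> = {f \<in> X 0. E f = 0}"
    proof -
      have "E f = 0 \<longleftrightarrow> \<epsilon> (\<phi> 0 f) = 0" for f by (simp add: E_def)
      moreover have "\<phi> 0 (\<psi> 0 x) = x" if "x \<in> hcomp (P 0) (int n)" for x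
        using \<phi>_\<psi> graded_module_carrier(2)[OF gm that] by blast
      ultimately show ?thesis unfolding \<psi>_hcomp[symmetric] by force
    qed
    finally show ?thesis .
  qed
  have exact: "D (Suc i) ` X (Suc (Suc i)) = {f \<in> X (Suc i). D i f = 0}" for i
  proof -
    have "D (Suc i) ` X (Suc (Suc i)) = \<psi> (Suc i) ` {x \<in> hcomp (P (Suc i)) (int n). \<delta> i x = 0}"
    proof -
      have "{x \<in> hcomp (P (Suc i)) (int n). x \<in> \<delta> (Suc i) ` carrier (P (Suc (Suc i)))}
          = {x \<in> hcomp (P (Suc i)) (int n). \<delta> i x = 0}"
        unfolding ker[symmetric] kernel_of_def using graded_module_carrier(2)[OF gm[of "Suc i"]] by blast
      then show ?thesis using image_D[of "Suc i"] homog_ker[of "Suc i"] by simp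
    qed
    also have "\<dots> = {f \<in> X (Suc i). D i f = 0}"
    proof -
      have "\<phi> (Suc i) (\<psi> (Suc i) x) = x" if "x \<in> hcomp (P (Suc i)) (int n)" for x
        using \<phi>_\<psi> graded_module_carrier(2)[OF gm that] by blast
      then show ?thesis unfolding \<psi>_hcomp[symmetric] D_zero by force
    qed
    finally show ?thesis .
  qed
  define r where "r i = (case i of 0 \<Rightarrow> dim (E ` X 0) | Suc j \<Rightarrow> fv.dim (D j ` X (Suc j)))" for i
  have X_subspace: "fv.subspace (X i)" for i unfolding X_def by (rule coords_subspace)
  have dimX: "fv.dim (X i) = r i + r (Suc i)" for i
  proof -
    obtain B where B: "finite B" "X i \<subseteq> fv.span B" using coords_finite_dim unfolding X_def by blast
    show ?thesis
    proof (cases i)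
      case 0
      have "fv.dim (X 0) = fv.dim {f \<in> X 0. E f = 0} + dim (E ` X 0)"
        using fs.rank_nullity[OF linE X_subspace B(1)] B(2) 0 by simp
      then show ?thesis using 0 exact0 by (simp add: r_def)
    next
      case (Suc j)
      have "fv.dim (X (Suc j)) = fv.dim {f \<in> X (Suc j). D j f = 0} + fv.dim (D j ` X (Suc j))"
        using ff.rank_nullity[OF linD X_subspace B(1)] B(2) Suc by simp
      then show ?thesis using Suc exact[of j] by (simp add: r_def)
    qed
  qed
  have r0: "r 0 = (if n = 0 then 1 else 0)"
  proof -
    have "\<epsilon> ` hcomp (P 0) (int n) = (if n = 0 then UNIV else {0})"
      using homogeneous_preimage[OF \<epsilon> gm trivial_module_direct_sum, of _ "int n"] \<epsilon>_surj graded_mapD(2)[OF \<epsilon>, of _ "int n"]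
      by (auto split: if_splits)
    moreover have "E ` X 0 = (\<lambda>c. scale c 1) ` (\<epsilon> ` hcomp (P 0) (int n))"
      unfolding \<phi>_X[symmetric] image_image E_def ..
    ultimately have "E ` X 0 = (if n = 0 then gr 0 else {0})" by (simp add: connected)
    then show ?thesis by (simp add: r_def dim_gr_0 dim_zero)
  qed
  have \<nu>_ge: "i \<le> \<nu> i" for i
  proof (induction i)
    case (Suc i) then show ?case using \<nu>(2)[of i] by simp
  qed simp
  have rn: "r (Suc n) = 0"
  proof -
    have "X (Suc n) = {0}"
      using \<nu>_ge[of "Suc n"] by (auto simp: X_def coords_def homog_def)
    moreover have "D n 0 = 0"
      using \<phi>_add[of "Suc n" 0 0] by (simp add: D_def \<delta>D(4) \<psi>D(4))
    ultimately show ?thesis by (simp add: r_def fdim_zero)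
  qed
  have "fv.dim (X i) = b i * (if \<nu> i \<le> n then dim (gr (n - \<nu> i)) else 0)" for i
    unfolding X_def dim_coords by (auto simp: homog_def dim_zero nat_diff_distrib simp flip: of_nat_diff)
  then have "(\<Sum>i\<le>n. (-1) ^ i * int (b i * (if \<nu> i \<le> n then dim (gr (n - \<nu> i)) else 0)))
    = (\<Sum>i\<le>n. (-1) ^ i * (int (r i) + int (r (Suc i))))"
    using dimX by (intro sum.cong) (auto simp flip: of_nat_add)
  also have "\<dots> = int (r 0)"
    using alternating_telescope[of "\<lambda>i. int (r i)" n] rn by simp
  finally show ?thesis using r0 by simp
qed

lemma regular_module_simps [simp]:
  "carrier regular_module = UNIV" "act regular_module = (*)"
  by (simp_all add: regular_module_def)

section \<open>The length of the resolution\<close>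

lemma module_map_A_plus_mult:
  assumes g: "module_map M regular_module g" and M: "graded_module M" and x: "x \<in> A_plus_mult M"
  shows "g x \<in> A_plus"
proof -
  note gD = module_mapD[OF g M]
  note sub = graded_module_carrier(1)[OF M]
  let ?T = "{x \<in> carrier M. g x \<in> A_plus}"
  have "add_subgroup ?T"
    unfolding add_subgroup_def
  proof (intro conjI ballI)
    show "0 \<in> ?T" using add_subgroup_closed(1)[OF sub] gD(4) subspace_0[OF A_plus_subspace] by simp
    fix x y assume xy: "x \<in> ?T" "y \<in> ?T"
    then have d: "x - y \<in> carrier M" using add_subgroup_closed(2)[OF sub] by simp
    have "g (x - y + y) = g (x - y) + g y" using xy by (intro gD(2)[OF d]) simp
    then have "g (x - y) = g x - g y" by simp
    then show "x - y \<in> ?T" using d xy subspace_diff[OF A_plus_subspace] by simp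
  qed
  moreover have "{act M a x |a x. a \<in> A_plus \<and> x \<in> carrier M} \<subseteq> ?T"
    using graded_moduleD(2)[OF M] gD(3) A_plus_mult_right by auto
  ultimately have "A_plus_mult M \<subseteq> ?T"
    unfolding A_plus_mult_def by (intro hull_minimal)
  then show ?thesis using x by blast
qed

text \<open>
  Every map out of the last term is a cocycle.  By minimality the coboundaries send the whole term
  into the augmentation ideal, which the first coordinate with respect to a free basis does not.
\<close>

lemma Ext_top_nonzero:
  assumes res: "minimal_projective_resolution trivial_module P \<delta> \<epsilon>"
    and fb: "free_basis (P q) \<nu> b e" and b: "b > 0" and top: "carrier (P (Suc q)) = {0}"
  shows "\<not> Ext_A_zero P \<delta> q"
proof
  assume zero: "Ext_A_zero P \<delta> q"
  have pr: "projective_resolution trivial_module P \<delta> \<epsilon>" and min: "\<delta> i ` carrier (P (Suc i)) \<subseteq> A_plus_mult (P i)" for i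
    using res by (auto simp: minimal_projective_resolution_def)
  have gm: "graded_module (P i)" for i using pr by (simp add: projective_resolution_def projective_def)
  have \<delta>: "graded_map (P (Suc i)) (P i) (\<delta> i)" for i using pr by (simp add: projective_resolution_def)
  note \<psi>D = module_mapD[OF graded_mapD(1)[OF coord_graded_map[OF gm fb]] gm]
  define f where "f x = (if x \<in> carrier (P q) then coord (P q) \<nu> b e x 0 else 0)" for x
  note sub = graded_module_carrier(1)[OF gm[of q]]
  have f: "f \<in> Hom_A (P q)"
    using \<psi>D(2,3) add_subgroup_closed(4)[OF sub] graded_moduleD(2)[OF gm[of q]]
    by (auto simp: Hom_A_def module_map_def f_def plus_fun_def)
  have f0: "f 0 = 0" using \<psi>D(4) by (simp add: f_def)
  have \<delta>0: "\<delta> q 0 = 0" by (rule module_mapD(4)[OF graded_mapD(1)[OF \<delta>] gm])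
  have cocycle: "f \<in> cocycles P \<delta> q" using f top f0 \<delta>0 by (simp add: cocycles_def)
  have zero_Hom: "0 \<in> Hom_A (P i)" for i by (simp add: Hom_A_def module_map_def)
  have zero_cob: "0 \<in> coboundaries P \<delta> q"
    using zero_Hom by (cases q) (auto intro!: bexI[of _ 0])
  have "ext_rel P \<delta> q `` {f} \<in> Ext_A P \<delta> q"
    unfolding Ext_A_def using cocycle by (rule quotientI)
  then have "ext_rel P \<delta> q `` {f} = ext_rel P \<delta> q `` {0}"
    using zero by (simp add: Ext_A_zero_def)
  moreover have "f \<in> ext_rel P \<delta> q `` {f}" using cocycle zero_cob by (simp add: ext_rel_def)
  ultimately have "0 - f \<in> coboundaries P \<delta> q" by (auto simp: ext_rel_def)
  \<comment> \<open>The value of \<open>f\<close> on the first basis element is one, which is not in the augmentation ideal.\<close>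
  have e0: "e 0 \<in> hcomp (P q) \<nu>" using fb b by (simp add: free_basis_def)
  have e0c: "e 0 \<in> carrier (P q)" by (rule graded_module_carrier(2)[OF gm e0])
  have fe: "f (e 0) = 1"
  proof -
    have "comb (P q) b e (unit_vec 0) = e 0"
      using fb b graded_module_carrier(2)[OF gm] by (intro comb_unit_vec[OF gm]) (auto simp: free_basis_def)
    moreover have "unit_vec 0 \<in> carrier (free_module b \<nu>)" using b by (simp add: unit_vec_def)
    ultimately have "coord (P q) \<nu> b e (e 0) = unit_vec 0" using coord_inverse(1)[OF fb] by metis
    then show ?thesis using e0c by (simp add: f_def unit_vec_def)
  qed
  have "(0 - f) (e 0) \<in> A_plus"
  proof (cases q)
    case 0
    then have "0 - f = 0" using \<open>0 - f \<in> coboundaries P \<delta> q\<close> by simp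
    then show ?thesis using subspace_0[OF A_plus_subspace] by simp
  next
    case (Suc p)
    then obtain g where g: "g \<in> Hom_A (P p)" "\<And>x. x \<in> carrier (P q) \<Longrightarrow> (0 - f) x = g (\<delta> p x)"
      using \<open>0 - f \<in> coboundaries P \<delta> q\<close> by auto
    have "\<delta> p (e 0) \<in> A_plus_mult (P p)" using min[of p] e0c Suc by blast
    then have "g (\<delta> p (e 0)) \<in> A_plus"
      using g(1) by (intro module_map_A_plus_mult[OF _ gm]) (simp_all add: Hom_A_def)
    then show ?thesis using g(2)[OF e0c] by simp
  qed
  then have "- 1 \<in> A_plus" using fe by simp
  then have "1 \<in> A_plus" using subspace_neg[OF A_plus_subspace] by fastforce
  then show False using one_notin_A_plus by simp
qed

end

section \<open>Growth and the Hilbert series\<close>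

lemma sum_coeff_mult_le:
  fixes f g :: "real fps"
  assumes "\<And>i. f $ i \<ge> 0" "\<And>i. g $ i \<ge> 0"
  shows "(\<Sum>k\<le>n. (f * g) $ k) \<le> (\<Sum>i\<le>n. f $ i) * (\<Sum>j\<le>n. g $ j)"
proof -
  have "(\<Sum>k\<le>n. (f * g) $ k) = (\<Sum>(i, j)\<in>{(i, j). i + j \<le> n}. f $ i * g $ j)"
    by (simp add: fps_mult_nth sum.triangle_reindex_eq atLeast0AtMost)
  also have "\<dots> \<le> (\<Sum>(i, j)\<in>{..n} \<times> {..n}. f $ i * g $ j)"
    using assms by (intro sum_mono2) auto
  also have "\<dots> = (\<Sum>i\<le>n. f $ i) * (\<Sum>j\<le>n. g $ j)"
    by (simp add: sum_product sum.cartesian_product)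
  finally show ?thesis .
qed

lemma inverse_one_minus_X_power:
  assumes "i > 0"
  shows "1 / (1 - fps_X ^ i) = (1 + divisor_fps i)"
proof -
  have u: "(1 - fps_X ^ i :: real fps) $ 0 \<noteq> 0" using assms by simp
  have "(1 - fps_X ^ i) * (1 + divisor_fps i) = 1"
    using divisor_fps_eq[OF assms] by (simp add: distrib_left)
  then have "inverse (1 - fps_X ^ i) = 1 + divisor_fps i"
    by (metis fps_inverse_unique)
  then show ?thesis using u by (simp add: fps_divide_unit)
qed

text \<open>
  Bounds \<open>(n + 1)^s\<close> for the partial sums up to \<open>n\<close> of nonnegative coefficients multiply, and each factor
  \<open>1 / (1 - x^i)\<close> has coefficients zero and one, which gives \<open>s = 1\<close>.
\<close>

lemma weighted_coeff_bound:
  fixes m :: nat and e :: "nat \<Rightarrow> nat"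
  defines "h \<equiv> \<Prod>i=1..m. (1 + divisor_fps i) ^ e i"
  shows "h $ k \<ge> 0" "(\<Sum>k\<le>n. h $ k) \<le> (real n + 1) ^ (\<Sum>i=1..m. e i)"
proof -
  let ?good = "\<lambda>(f :: real fps) s. (\<forall>k. f $ k \<ge> 0) \<and> (\<forall>n. (\<Sum>k\<le>n. f $ k) \<le> (real n + 1) ^ s)"
  have one: "?good 1 0" by (auto simp: if_distrib sum.delta cong: if_cong)
  have mult: "?good (f * g) (s + t)" if fg: "?good f s" "?good g t" for f g s t
  proof (intro conjI allI)
    show "(f * g) $ k \<ge> 0" for k
      using fg by (auto simp: fps_mult_nth intro!: sum_nonneg mult_nonneg_nonneg)
    fix n
    have "(\<Sum>k\<le>n. (f * g) $ k) \<le> (\<Sum>i\<le>n. f $ i) * (\<Sum>j\<le>n. g $ j)"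
      using fg by (intro sum_coeff_mult_le) auto
    also have "\<dots> \<le> (real n + 1) ^ s * (real n + 1) ^ t"
      using fg by (intro mult_mono sum_nonneg) auto
    finally show "(\<Sum>k\<le>n. (f * g) $ k) \<le> (real n + 1) ^ (s + t)" by (simp add: power_add)
  qed
  have factor: "?good (1 + divisor_fps i) 1" for i
  proof (intro conjI allI)
    have le: "(1 + divisor_fps i) $ k \<le> 1" for k by (auto simp: divisor_fps_def)
    show "(1 + divisor_fps i) $ k \<ge> 0" for k by (auto simp: divisor_fps_def)
    show "(\<Sum>k\<le>n. (1 + divisor_fps i) $ k) \<le> (real n + 1) ^ 1" for n
      using sum_mono[of "{..n}" "\<lambda>k. (1 + divisor_fps i) $ k" "\<lambda>_. 1"] le by simp
  qed
  have power: "?good ((1 + divisor_fps i) ^ j) j" for i j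
  proof (induction j)
    case (Suc j)
    from mult[OF factor[of i] this] show ?case by simp
  qed (use one in simp)
  have "?good (\<Prod>i\<in>A. (1 + divisor_fps i) ^ e i) (\<Sum>i\<in>A. e i)" if "finite A" for A
    using that
  proof (induction A rule: finite_induct)
    case (insert x F)
    from mult[OF power[of x "e x"] insert.IH] insert.hyps show ?case by simp
  qed (use one in simp)
  from this[of "{1..m}"] show "h $ k \<ge> 0" "(\<Sum>k\<le>n. h $ k) \<le> (real n + 1) ^ (\<Sum>i=1..m. e i)"
    by (simp_all add: h_def)
qed

context graded_algebra
begin

lemma dim_span_Union_le: "dim (span (\<Union>i\<le>n. gr i)) \<le> (\<Sum>i\<le>n. dim (gr i))"
proof -
  have "\<exists>B. finite B \<and> gr i \<subseteq> span B \<and> card B = dim (gr i)" for i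
  proof -
    obtain E where E: "finite E" "gr i = span E" using locally_finite by blast
    obtain B where B: "B \<subseteq> gr i" "independent B" "gr i \<subseteq> span B" "card B = dim (gr i)"
      by (rule basis_exists)
    then have "finite B" using independent_span_bound[OF E(1) B(2)] E(2) by blast
    then show ?thesis using B by blast
  qed
  then obtain B where B: "\<And>i. finite (B i)" "\<And>i. gr i \<subseteq> span (B i)" "\<And>i. card (B i) = dim (gr i)"
    by metis
  have "dim (span (\<Union>i\<le>n. gr i)) \<le> card (\<Union>i\<le>n. B i)"
  proof (rule dim_le_card)
    have "gr i \<subseteq> span (\<Union>i\<le>n. B i)" if "i \<le> n" for i
      using B(2)[of i] span_mono[of "B i" "\<Union>i\<le>n. B i"] that by blast
    then show "span (\<Union>i\<le>n. gr i) \<subseteq> span (\<Union>i\<le>n. B i)" by (intro span_minimal) auto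
  qed (use B(1) in auto)
  also have "\<dots> \<le> (\<Sum>i\<le>n. card (B i))" by (rule card_UN_le) simp
  finally show ?thesis by (simp add: B(3))
qed

text \<open>
  The order of the pole of the Hilbert series at one, which is the sum of the \<open>e i\<close>, bounds
  the GK dimension.
\<close>

lemma GKdim_le:
  assumes h: "hilbert_series = (\<Prod>i=1..m. 1 / (1 - fps_X ^ i) ^ e i)"
  shows "GKdim \<le> ereal (real (\<Sum>i=1..m. e i))"
proof -
  define s where "s = (\<Sum>i=1..m. e i)"
  have h': "hilbert_series = (\<Prod>i=1..m. (1 + divisor_fps i) ^ e i)"
    unfolding h
  proof (rule prod.cong)
    fix i assume "i \<in> {1..m}"
    then have i: "i > 0" by simp
    have u: "(1 - fps_X ^ i :: real fps) $ 0 \<noteq> 0" using i by simp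
    then have "1 / (1 - fps_X ^ i) ^ e i = (1 / (1 - fps_X ^ i :: real fps)) ^ e i"
      by (simp add: fps_divide_unit fps_power_zeroth fps_inverse_power)
    then show "1 / (1 - fps_X ^ i) ^ e i = (1 + divisor_fps i) ^ e i"
      by (simp only: inverse_one_minus_X_power[OF i])
  qed simp
  have bound: "real (dim (span (\<Union>i\<le>n. gr i))) \<le> (real n + 1) ^ s" for n
  proof -
    have "real (dim (span (\<Union>i\<le>n. gr i))) \<le> real (\<Sum>i\<le>n. dim (gr i))"
      using dim_span_Union_le by (simp only: of_nat_le_iff)
    also have "\<dots> = (\<Sum>i\<le>n. hilbert_series $ i)" by (simp add: hilbert_series_def)
    also have "\<dots> \<le> (real n + 1) ^ s"
      unfolding h' s_def by (rule weighted_coeff_bound(2))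
    finally show ?thesis .
  qed
  have "GKdim \<le> limsup (\<lambda>n. ereal (real s * (1 + inverse (real n) / ln 2)))"
    unfolding GKdim_def
  proof (rule Limsup_mono)
    show "\<forall>\<^sub>F n in sequentially. ereal (log (real n) (real (dim (span (\<Union>i\<le>n. gr i)))))
        \<le> ereal (real s * (1 + inverse (real n) / ln 2))"
      using eventually_ge_at_top[of 2]
    proof eventually_elim
      case (elim n)
      let ?x = "real (dim (span (\<Union>i\<le>n. gr i)))"
      have pos: "0 < ln (2 :: real)" "ln 2 \<le> ln (real n)" "0 < ln (real n)" using elim by simp_all
      have "ln ?x \<le> ln ((real n + 1) ^ s)"
      proof (cases "?x = 0")
        case True
        then show ?thesis by (simp add: ln_realpow)
      next
        case False
        then have "0 < ?x" by simp
        then show ?thesis using bound[of n] by (simp add: ln_mono)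
      qed
      also have "\<dots> = real s * ln (real n + 1)" by (simp add: ln_realpow)
      also have "real n + 1 = real n * (1 + inverse (real n))" using elim by (simp add: field_simps)
      also have "ln \<dots> = ln (real n) + ln (1 + inverse (real n))"
        using elim by (intro ln_mult_pos) (auto simp: add_pos_pos)
      also have "\<dots> \<le> ln (real n) + inverse (real n)"
        by (intro add_left_mono ln_add_one_self_le_self) simp
      finally have "ln ?x \<le> real s * (ln (real n) + inverse (real n))"
        by (simp add: mult_left_mono)
      then have "ln ?x / ln (real n) \<le> real s * (ln (real n) + inverse (real n)) / ln (real n)"
        using pos by (intro divide_right_mono) auto
      also have "\<dots> = real s * (1 + inverse (real n) / ln (real n))"
        using pos by (simp add: field_simps)
      also have "\<dots> \<le> real s * (1 + inverse (real n) / ln 2)"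
        using pos by (intro mult_left_mono add_left_mono divide_left_mono) auto
      finally show ?case by (simp add: log_def)
    qed
  qed
  also have "limsup (\<lambda>n. ereal (real s * (1 + inverse (real n) / ln 2))) = ereal (real s)"
  proof (rule lim_imp_Limsup)
    have "((\<lambda>n. real s * (1 + inverse (real n) / ln 2)) \<longlongrightarrow> real s * (1 + 0 / ln 2)) sequentially"
      by (intro tendsto_intros lim_inverse_n) simp
    then show "((\<lambda>n. ereal (real s * (1 + inverse (real n) / ln 2))) \<longlongrightarrow> ereal (real s)) sequentially"
      by (intro tendsto_ereal) simp
  qed simp
  finally show ?thesis by (simp add: s_def)
qed

section \<open>Koszul algebras with the Hilbert series of a weighted polynomial ring\<close>

lemma koszul_degree_even: "koszul_degree N (2 * k) = k * N"
  and koszul_degree_odd: "koszul_degree N (Suc (2 * k)) = k * N + 1"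
  by (simp_all add: koszul_degree_def)

lemma koszul_degree_less: "N \<ge> 2 \<Longrightarrow> koszul_degree N i < koszul_degree N (Suc i)"
proof (cases "even i")
  case True
  then obtain k where "i = 2 * k" by auto
  then show ?thesis by (simp add: koszul_degree_even koszul_degree_odd)
next
  case False
  then obtain k where "i = Suc (2 * k)" using oddE by fastforce
  then show "N \<ge> 2 \<Longrightarrow> ?thesis" using koszul_degree_even[of N "Suc k"] by (simp add: koszul_degree_odd)
qed

text \<open>
  The second property says that the sequence \<open>b\<close> can only drop to zero after index \<open>d\<close>, by the
  Gorenstein condition.
\<close>

lemma koszul_betti_numbers:
  assumes K: "N_Koszul N" and G: "Gorenstein d"
  shows "\<exists>b. (\<forall>n. (\<Sum>i\<le>n. (-1) ^ i * int (b i * (if koszul_degree N i \<le> n then dim (gr (n - koszul_degree N i)) else 0)))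
      = (if n = 0 then 1 else 0)) \<and> (\<forall>i. b i \<noteq> 0 \<longrightarrow> b (Suc i) = 0 \<longrightarrow> i = d)"
proof -
  obtain P \<delta> \<epsilon> where res: "minimal_projective_resolution trivial_module P \<delta> \<epsilon>"
    and gen: "\<And>i. generated_in_degree (P i) (int (koszul_degree N i))" and N: "N \<ge> 2"
    using K by (auto simp: N_Koszul_def)
  have pr: "projective_resolution trivial_module P \<delta> \<epsilon>"
    using res by (simp add: minimal_projective_resolution_def)
  have k0: "koszul_degree N 0 = 0" by (simp add: koszul_degree_def)
  have "\<exists>b e. free_basis (P i) (int (koszul_degree N i)) b e" for i
    by (rule resolution_free[OF pr gen k0 koszul_degree_less[OF N]])
  then obtain b e where fb: "\<And>i. free_basis (P i) (int (koszul_degree N i)) (b i) (e i)" by metis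
  show ?thesis
  proof (intro exI[of _ b] conjI allI impI)
    fix i assume i: "b i \<noteq> 0" "b (Suc i) = 0"
    have "carrier (P (Suc i)) = comb (P (Suc i)) 0 (e (Suc i)) ` carrier (free_module 0 (int (koszul_degree N (Suc i))))"
      using fb[of "Suc i"] i(2) by (simp add: free_basis_def bij_betw_def)
    also have "\<dots> = {0}" by (auto simp: comb_def)
    finally have "\<not> Ext_A_zero P \<delta> i" using Ext_top_nonzero[OF res fb] i(1) by simp
    then show "i = d" using G pr unfolding Gorenstein_def by blast
  qed (rule resolution_euler_characteristic[OF pr fb k0 koszul_degree_less[OF N]])
qed

text \<open>
  The Euler characteristic says that the series with coefficients \<open>(-1)^j b j\<close> at \<open>\<nu> j\<close> is inverse to
  the Hilbert series, hence equal to the product, which is a polynomial.  So only finitely many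
  \<open>b j\<close> are nonzero, and the last one has index \<open>d\<close>.
\<close>

lemma koszul_hilbert_polynomial:
  assumes K: "N_Koszul N" and G: "Gorenstein d"
    and h: "hilbert_series = (\<Prod>i=1..m. 1 / (1 - fps_X ^ i) ^ e i)"
  shows "\<exists>b. (\<Sum>j\<le>d. monom ((-1) ^ j * real (b j)) (koszul_degree N j)) = (\<Prod>i=1..m. (1 - monom 1 i) ^ e i)"
proof -
  let ?\<nu> = "koszul_degree N"
  obtain b where euler: "\<forall>n. (\<Sum>i\<le>n. (-1) ^ i * int (b i * (if ?\<nu> i \<le> n then dim (gr (n - ?\<nu> i)) else 0)))
      = (if n = 0 then 1 else 0)"
    and last: "\<forall>i. b i \<noteq> 0 \<longrightarrow> b (Suc i) = 0 \<longrightarrow> i = d"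
    using koszul_betti_numbers[OF K G] by (elim exE conjE)
  have N: "N \<ge> 2" using K by (simp add: N_Koszul_def)
  have mono: "strict_mono ?\<nu>" using koszul_degree_less[OF N] by (simp add: strict_mono_Suc_iff)
  have \<nu>_ge: "i \<le> ?\<nu> i" for i using mono by (rule strict_mono_imp_increasing)
  define c where "c i = (-1) ^ i * real (b i)" for i
  define p where "p = Abs_fps (\<lambda>n. \<Sum>i\<le>n. if ?\<nu> i = n then c i else 0)"
  have p_nth: "p $ n = (\<Sum>i\<le>k. if ?\<nu> i = n then c i else 0)" if "n \<le> k" for n k
    unfolding p_def fps_nth_Abs_fps
  proof (rule sum.mono_neutral_left)
    show "\<forall>i\<in>{..k} - {..n}. (if ?\<nu> i = n then c i else 0) = 0"
    proof
      fix i assume "i \<in> {..k} - {..n}"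
      then show "(if ?\<nu> i = n then c i else 0) = 0" using \<nu>_ge[of i] by auto
    qed
  qed (use that in auto)
  define q where "q = (\<Prod>i=1..m. (1 - monom 1 i) ^ e i :: real poly)"
  have q_fps: "fps_of_poly q = (\<Prod>i=1..m. (1 - fps_X ^ i) ^ e i)"
    by (simp add: q_def fps_of_poly_prod fps_of_poly_power fps_of_poly_diff fps_of_poly_monom)
  have ph: "p * hilbert_series = 1"
  proof (rule fps_ext)
    fix n
    have "(p * hilbert_series) $ n = (\<Sum>j\<le>n. \<Sum>i\<le>n. if ?\<nu> i = j then c i * real (dim (gr (n - ?\<nu> i))) else 0)"
      unfolding fps_mult_nth atLeast0AtMost
      by (intro sum.cong refl) (auto simp: p_nth[of _ n] hilbert_series_def sum_distrib_right intro!: sum.cong)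
    also have "\<dots> = (\<Sum>i\<le>n. \<Sum>j\<le>n. if ?\<nu> i = j then c i * real (dim (gr (n - ?\<nu> i))) else 0)"
      by (rule sum.swap)
    also have "\<dots> = (\<Sum>i\<le>n. real_of_int ((-1) ^ i * int (b i * (if ?\<nu> i \<le> n then dim (gr (n - ?\<nu> i)) else 0))))"
      by (intro sum.cong refl) (auto simp: c_def)
    also have "\<dots> = real_of_int (if n = 0 then 1 else 0)"
      by (simp only: euler[rule_format] flip: of_int_sum)
    finally show "(p * hilbert_series) $ n = 1 $ n" by simp
  qed
  have "fps_of_poly q * hilbert_series = 1"
  proof -
    have "(1 - fps_X ^ i) ^ e i * (1 / (1 - fps_X ^ i) ^ e i) = (1 :: real fps)" if "i \<in> {1..m}" for i
    proof -
      have "((1 - fps_X ^ i) ^ e i :: real fps) $ 0 \<noteq> 0" using that by (cases i) (simp_all add: fps_power_zeroth)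
      then show ?thesis by (simp add: fps_divide_unit inverse_mult_eq_1')
    qed
    then show ?thesis unfolding h q_fps prod.distrib[symmetric] by simp
  qed
  then have p_eq: "p = fps_of_poly q"
    using ph by (metis mult.assoc mult.commute mult_1_right)
  have coeff: "c i = coeff q (?\<nu> i)" for i
  proof -
    have "p $ ?\<nu> i = (\<Sum>j\<le>?\<nu> i. if j = i then c j else 0)"
      using strict_mono_eq[OF mono] by (simp add: p_def)
    then show ?thesis using \<nu>_ge[of i] p_eq by simp
  qed
  have "b i = 0" if "i > degree q" for i
    using coeff[of i] coeff_eq_0[of q "?\<nu> i"] \<nu>_ge[of i] that by (simp add: c_def)
  then have sub: "{i. b i \<noteq> 0} \<subseteq> {..degree q}" by (auto simp: not_less[symmetric])
  then have fin: "finite {i. b i \<noteq> 0}" by (rule finite_subset) simp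
  have "b 0 \<noteq> 0"
  proof
    assume "b 0 = 0"
    then have "(\<Sum>i\<le>0. (-1) ^ i * int (b i * (if ?\<nu> i \<le> 0 then dim (gr (0 - ?\<nu> i)) else 0))) = 0"
      by (intro sum.neutral) simp
    with euler[rule_format, of 0] show False by (simp only: if_P simp_thms zero_neq_one)
  qed
  then have ne: "{i. b i \<noteq> 0} \<noteq> {}" by blast
  define D where "D = Max {i. b i \<noteq> 0}"
  have D: "b D \<noteq> 0" "\<And>i. b i \<noteq> 0 \<Longrightarrow> i \<le> D"
    using Max_in[OF fin ne] Max_ge[OF fin] by (auto simp: D_def)
  then have "b (Suc D) = 0" using not_less_eq_eq by blast
  then have "D = d" using last D(1) by blast
  then have big: "b i = 0" if "i > d" for i using D(2)[of i] that by auto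
  have "(\<Sum>j\<le>d. monom (c j) (?\<nu> j)) = q"
  proof (rule poly_eqI)
    fix n
    have "coeff q n = (\<Sum>i\<le>max n d. if ?\<nu> i = n then c i else 0)"
      using p_nth[of n "max n d"] p_eq by simp
    also have "\<dots> = (\<Sum>i\<le>d. if ?\<nu> i = n then c i else 0)"
      using big by (intro sum.mono_neutral_right) (auto simp: c_def)
    finally show "coeff (\<Sum>j\<le>d. monom (c j) (?\<nu> j)) n = coeff q n" by (simp add: coeff_sum)
  qed
  then show ?thesis unfolding c_def q_def by blast
qed

lemma koszul_AS_regular_weighted:
  assumes N: "N \<ge> 3" and d: "d \<ge> 2" and K: "N_Koszul N" and G: "Gorenstein d"
    and W: "weighted_polynomial_hilbert_series" and GK: "GKdim = ereal (real d)"
  shows "N = 3 \<and> d = 3"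
proof -
  obtain m e where h: "hilbert_series = (\<Prod>i=1..m. 1 / (1 - fps_X ^ i) ^ e i)"
    using W unfolding weighted_polynomial_hilbert_series_def by blast
  obtain b where b: "(\<Sum>j\<le>d. monom ((-1) ^ j * real (b j)) (koszul_degree N j)) = (\<Prod>i=1..m. (1 - monom 1 i) ^ e i)"
    using koszul_hilbert_polynomial[OF K G h] by blast
  define n where "n i = (if i \<le> m then e i else 0)" for i
  have "(\<Prod>i=1..m + N. (1 - monom 1 i) ^ n i :: real poly) = (\<Prod>i=1..m. (1 - monom 1 i) ^ e i)"
    by (rule prod.mono_neutral_cong_right) (auto simp: n_def)
  moreover have "(\<Sum>i=1..m + N. n i) = (\<Sum>i=1..m. e i)"
    by (rule sum.mono_neutral_cong_right) (auto simp: n_def)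
  moreover have "d \<le> (\<Sum>i=1..m. e i)" using GKdim_le[OF h] unfolding GK by (simp only: ereal_less_eq of_nat_le_iff)
  ultimately interpret koszul_numerator N d "m + N" "koszul_degree N" b n
    using N d b koszul_degree_even koszul_degree_odd by unfold_locales auto
  show ?thesis by (rule N_d_eq_3)
qed

end

theorem corollary0p8:
  fixes scale :: "'k::field \<Rightarrow> 'a::ring_1 \<Rightarrow> 'a"
    and gr :: "nat \<Rightarrow> 'a set"
    and N d :: nat
  assumes "graded_algebra scale gr"
    and "N \<ge> 3"
    and "d \<ge> 2"
    and "graded_algebra.N_Koszul scale gr N"
    and "graded_algebra.AS_regular scale gr d"
    and "graded_algebra.weighted_polynomial_hilbert_series scale gr"
    and "graded_algebra.GKdim scale gr = ereal (real d)"
  shows "graded_algebra.N_Koszul scale gr 3 \<and> graded_algebra.AS_regular scale gr 3"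
proof -
  interpret graded_algebra scale gr by fact
  have "Gorenstein d" using assms(5) by (simp add: AS_regular_def)
  then have "N = 3 \<and> d = 3"
    using koszul_AS_regular_weighted[of N d] assms by blast
  then show ?thesis using assms(4,5) by simp
qed

end
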